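(* Let $A\subset \mathbb{R}^{\ell+1}$ be a compact $C^\infty$-smooth $\ell$-dimensional manifold without boundary, and let $s>0$ with $\ell-1\leqslant s<\ell$. Then there exists a positive constant $c(A,s)$ such that for every sequence $\omega^*_\infty = \{a^*_j\}_{j=1}^\infty$ of greedy $s$-energy points on $A$ and any $i<j$, $$|a^*_i - a^*_j|\geqslant c(A, s)\,j^{-1/\ell}.$$
   Context: $\ell\geqslant 1$ is an integer; the manifold is an embedded submanifold of $\mathbb{R}^{\ell+1}$. A sequence $\{a^*_j\}_{j=1}^\infty\subset A$ is called a sequence of greedy $s$-energy points if $a^*_1\in A$ and for every $N>1$ $$\sum_{j=1}^{N-1}\frac{1}{|a^*_N-a^*_j|^s} = \inf_{y\in A}\sum_{j=1}^{N-1}\frac{1}{|y-a^*_j|^s},$$ with the convention $1/0^s=+\infty$. *)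

theory Defs
  imports "HOL-Analysis.Analysis"
begin

text \<open>
  The set \<open>S\<close> is meant to be open, so that the Frechet derivatives are uniquely determined; \<open>C\<^sup>k\<close>
  is expressed by iterating directional derivatives.
\<close>

primrec Ck_on :: "nat \<Rightarrow> 'a::euclidean_space set \<Rightarrow> ('a \<Rightarrow> 'b::euclidean_space) \<Rightarrow> bool" where
  "Ck_on 0 S f \<longleftrightarrow> continuous_on S f"
| "Ck_on (Suc k) S f \<longleftrightarrow>
     (\<forall>x\<in>S. f differentiable (at x)) \<and>
     (\<forall>v. Ck_on k S (\<lambda>x. frechet_derivative f (at x) v))"

definition C_infinity_on :: "'a::euclidean_space set \<Rightarrow> ('a \<Rightarrow> 'b::euclidean_space) \<Rightarrow> bool" where
  "C_infinity_on S f \<longleftrightarrow> (\<forall>k. Ck_on k S f)"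

definition C_infinity_diffeomorphism ::
    "'a::euclidean_space set \<Rightarrow> 'b::euclidean_space set \<Rightarrow> ('a \<Rightarrow> 'b) \<Rightarrow> ('b \<Rightarrow> 'a) \<Rightarrow> bool" where
  "C_infinity_diffeomorphism U V \<phi> \<psi> \<longleftrightarrow>
     homeomorphism U V \<phi> \<psi> \<and> C_infinity_on U \<phi> \<and> C_infinity_on V \<psi>"

text \<open>
  Embedded submanifolds without boundary, by slice charts: near each of its points, a
  diffeomorphism between open subsets of the ambient space takes \<open>M\<close> to an open piece of an
  \<open>l\<close>-dimensional linear subspace \<open>L\<close>. Up to a linear change of coordinates, \<open>L\<close> is the
  coordinate subspace of the first \<open>l\<close> coordinates.
\<close>

definition smooth_submanifold :: "nat \<Rightarrow> 'a::euclidean_space set \<Rightarrow> bool" where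
  "smooth_submanifold l M \<longleftrightarrow>
     (\<forall>p\<in>M. \<exists>U V \<phi> \<psi> L.
        open U \<and> p \<in> U \<and> open (V :: 'a set) \<and>
        C_infinity_diffeomorphism U V \<phi> \<psi> \<and>
        subspace L \<and> dim L = l \<and>
        \<phi> ` (U \<inter> M) = V \<inter> L)"

text \<open>
  The kernel takes values in \<^typ>\<open>ennreal\<close>, where division by zero gives \<open>1 / 0 = \<infinity>\<close>; for
  \<open>s > 0\<close> its value on the diagonal is therefore \<open>\<infinity>\<close>.
\<close>

definition riesz_kernel :: "real \<Rightarrow> 'a::euclidean_space \<Rightarrow> 'a \<Rightarrow> ennreal" where
  "riesz_kernel s x y = 1 / ennreal (norm (x - y) powr s)"

lemma riesz_kernel_diagonal: "riesz_kernel s x x = \<infinity>"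
  by (simp add: riesz_kernel_def divide_ennreal_def)

lemma riesz_kernel_off_diagonal:
  "x \<noteq> y \<Longrightarrow> riesz_kernel s x y = ennreal (1 / norm (x - y) powr s)"
  by (simp add: riesz_kernel_def divide_ennreal flip: ennreal_1)

text \<open>Sequences are indexed from \<open>1\<close>; the value \<open>a 0\<close> is irrelevant.\<close>

definition greedy_energy_points ::
    "real \<Rightarrow> 'a::euclidean_space set \<Rightarrow> (nat \<Rightarrow> 'a) \<Rightarrow> bool" where
  "greedy_energy_points s A a \<longleftrightarrow>
     (\<forall>j\<ge>1. a j \<in> A) \<and>
     (\<forall>N>1. (\<Sum>j=1..N-1. riesz_kernel s (a N) (a j)) =
             (INF y\<in>A. \<Sum>j=1..N-1. riesz_kernel s y (a j)))"

end

theory Submission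
  imports Defs
begin

text \<open>
  Add a variable \<open>w = z\<^sup>2 \<ge> 0\<close> and extend the potential of the points to
  \<open>U(x,w) = \<Sum>\<^sub>j (|x - a\<^sub>j|\<^sup>2 + w)\<^sup>-\<^sup>s\<^sup>/\<^sup>2\<close>. Off the points it solves a degenerate elliptic equation
  \<open>L U = 0\<close>, and since \<open>s \<ge> l - 1\<close> the operator \<open>L\<close> satisfies a minimum principle up to the boundary
  \<open>w = 0\<close>. Let \<open>p = a\<^sub>N\<close>, and let \<open>m = U(p,0)\<close> be the minimum of the potential of the first \<open>N - 1\<close>
  points on \<open>A\<close>. Near \<open>A\<close>, the distance to \<open>A \<times> {0}\<close> raised to the power \<open>l - s\<close> is almost
  \<open>L\<close>-harmonic, and a barrier built from it gives \<open>U \<ge> m (1 - C R\<^sup>l\<^sup>-\<^sup>s)\<close> at distance \<open>R\<close> from \<open>p\<close>. At a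
  point above \<open>p\<close> at a fixed height this yields \<open>m \<le> C N\<close>. If some \<open>a\<^sub>i\<close> with \<open>i < N\<close> is closer to \<open>p\<close> than
  \<open>\<rho> / 2\<close>, where \<open>\<rho>\<close> is of order \<open>N\<^sup>-\<^sup>1\<^sup>/\<^sup>l\<close>, remove its term from \<open>U\<close>: on the sphere of radius \<open>\<rho>\<close>
  the rest is at least \<open>m - C \<rho>\<^sup>-\<^sup>s\<close>, hence also at \<open>p\<close>, where it equals
  \<open>m - |a\<^sub>N - a\<^sub>i|\<^sup>-\<^sup>s\<close>.
\<close>

section \<open>Second-order operators along lines\<close>

text \<open>The first derivative is required near \<open>t\<close>, the second only at
  \<open>t\<close>. As a pointwise relation it also applies to powers, which are differentiable only
  where the base is positive. At \<open>w = 0\<close> it still asks for a two-sided neighbourhood,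
  which exists as long as the base is positive there.\<close>

definition jet2 :: "(real \<Rightarrow> real) \<Rightarrow> real \<Rightarrow> real \<Rightarrow> real \<Rightarrow> bool" where
  "jet2 f t b c \<longleftrightarrow> (\<exists>f'. (\<forall>\<^sub>F u in nhds t. (f has_real_derivative f' u) (at u)) \<and>
      f' t = b \<and> (f' has_real_derivative c) (at t))"

lemma jet2I:
  assumes "\<forall>\<^sub>F u in nhds t. (f has_real_derivative f' u) (at u)"
    and "(f' has_real_derivative c) (at t)" and "f' t = b"
  shows "jet2 f t b c"
  using assms unfolding jet2_def by blast

lemma jet2_const: "jet2 (\<lambda>_. k) t 0 0"
  by (rule jet2I[where f' = "\<lambda>_. 0"]) (auto intro!: always_eventually)

lemma jet2_ident: "jet2 (\<lambda>u. u) t 1 0"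
  by (rule jet2I[where f' = "\<lambda>_. 1"]) (auto intro!: always_eventually)

lemma jet2_add:
  assumes "jet2 f t b c" "jet2 g t b' c'"
  shows "jet2 (\<lambda>u. f u + g u) t (b + b') (c + c')"
proof -
  from assms obtain f' g' where
    "\<forall>\<^sub>F u in nhds t. (f has_real_derivative f' u) (at u)" "f' t = b" "(f' has_real_derivative c) (at t)"
    "\<forall>\<^sub>F u in nhds t. (g has_real_derivative g' u) (at u)" "g' t = b'" "(g' has_real_derivative c') (at t)"
    unfolding jet2_def by blast
  note h = this
  show ?thesis
    by (rule jet2I[where f' = "\<lambda>u. f' u + g' u"])
      (use h in \<open>auto intro!: derivative_intros elim: eventually_elim2\<close>)
qed

lemma jet2_mult:
  assumes "jet2 f t b c" "jet2 g t b' c'"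
  shows "jet2 (\<lambda>u. f u * g u) t (b * g t + f t * b') (c * g t + 2 * b * b' + f t * c')"
proof -
  from assms obtain f' g' where h:
    "\<forall>\<^sub>F u in nhds t. (f has_real_derivative f' u) (at u)" "f' t = b" "(f' has_real_derivative c) (at t)"
    "\<forall>\<^sub>F u in nhds t. (g has_real_derivative g' u) (at u)" "g' t = b'" "(g' has_real_derivative c') (at t)"
    unfolding jet2_def by blast
  have ft: "(f has_real_derivative b) (at t)" "(g has_real_derivative b') (at t)"
    using eventually_nhds_x_imp_x[OF h(1)] eventually_nhds_x_imp_x[OF h(4)] h by auto
  show ?thesis
  proof (rule jet2I[where f' = "\<lambda>u. f' u * g u + f u * g' u"])
    show "\<forall>\<^sub>F u in nhds t. ((\<lambda>u. f u * g u) has_real_derivative f' u * g u + f u * g' u) (at u)"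
      using h(1,4) by eventually_elim (auto intro!: derivative_eq_intros)
    show "((\<lambda>u. f' u * g u + f u * g' u) has_real_derivative c * g t + 2 * b * b' + f t * c') (at t)"
      using h(2,3,5,6) ft by (auto intro!: derivative_eq_intros simp: algebra_simps)
  qed (use h in auto)
qed

lemma jet2_cmult: "jet2 f t b c \<Longrightarrow> jet2 (\<lambda>u. k * f u) t (k * b) (k * c)"
  using jet2_mult[OF jet2_const, of f t b c k] by simp

lemma jet2_sum:
  assumes "\<And>j. j \<in> J \<Longrightarrow> jet2 (f j) t (b j) (c j)"
  shows "jet2 (\<lambda>u. \<Sum>j\<in>J. f j u) t (\<Sum>j\<in>J. b j) (\<Sum>j\<in>J. c j)"
proof (cases "finite J")
  case True
  then show ?thesis using assms
    by (induction J) (auto intro!: jet2_add jet2_const)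
qed (simp add: jet2_const)

lemma jet2_chain:
  assumes "jet2 f t b c"
    and "\<forall>\<^sub>F y in nhds (f t). (\<Theta> has_real_derivative \<Theta>1 y) (at y)"
    and "(\<Theta>1 has_real_derivative \<theta>) (at (f t))"
  shows "jet2 (\<lambda>u. \<Theta> (f u)) t (\<Theta>1 (f t) * b) (\<theta> * b\<^sup>2 + \<Theta>1 (f t) * c)"
proof -
  from assms(1) obtain f' where h:
    "\<forall>\<^sub>F u in nhds t. (f has_real_derivative f' u) (at u)" "f' t = b" "(f' has_real_derivative c) (at t)"
    unfolding jet2_def by blast
  have ft: "(f has_real_derivative b) (at t)"
    using eventually_nhds_x_imp_x[OF h(1)] h by auto
  have "filterlim f (nhds (f t)) (nhds t)"
    using DERIV_isCont[OF ft] by (simp add: continuous_at_imp_continuous_at_within isCont_def tendsto_at_iff_tendsto_nhds)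
  with assms(2) have ev: "\<forall>\<^sub>F u in nhds t. (\<Theta> has_real_derivative \<Theta>1 (f u)) (at (f u))"
    by (auto simp: filterlim_iff)
  show ?thesis
  proof (rule jet2I[where f' = "\<lambda>u. \<Theta>1 (f u) * f' u"])
    show "\<forall>\<^sub>F u in nhds t. ((\<lambda>u. \<Theta> (f u)) has_real_derivative \<Theta>1 (f u) * f' u) (at u)"
      using h(1) ev by eventually_elim (rule DERIV_chain2)
    have "((\<lambda>u. \<Theta>1 (f u)) has_real_derivative \<theta> * b) (at t)"
      using assms(3) ft by (rule DERIV_chain2)
    then show "((\<lambda>u. \<Theta>1 (f u) * f' u) has_real_derivative \<theta> * b\<^sup>2 + \<Theta>1 (f t) * c) (at t)"
      using h(2,3) by (auto intro!: derivative_eq_intros simp: power2_eq_square)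
  qed (use h in auto)
qed

lemma jet2_powr:
  assumes "jet2 f t b c" "f t > 0"
  shows "jet2 (\<lambda>u. f u powr r) t (r * f t powr (r - 1) * b)
           (r * (r - 1) * f t powr (r - 2) * b\<^sup>2 + r * f t powr (r - 1) * c)"
proof (rule jet2_chain[OF assms(1)])
  have "\<forall>\<^sub>F y in nhds (f t). y > 0"
    using assms(2) by (intro eventually_nhds_in_open[of "{0<..}", simplified]) auto
  then show "\<forall>\<^sub>F y in nhds (f t). ((\<lambda>y. y powr r) has_real_derivative r * y powr (r - 1)) (at y)"
    by eventually_elim (rule has_real_derivative_powr)
  show "((\<lambda>y. r * y powr (r - 1)) has_real_derivative r * (r - 1) * f t powr (r - 2)) (at (f t))"
    using assms(2) by (auto intro!: derivative_eq_intros)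
qed

section \<open>Derivative tests at interior and one-sided minima\<close>

lemma jet2_local_min_first:
  assumes "jet2 f t b c" "\<forall>\<^sub>F u in nhds t. f t \<le> f u"
  shows "b = 0"
proof -
  from assms(1) have ft: "(f has_real_derivative b) (at t)"
    unfolding jet2_def using eventually_nhds_x_imp_x by blast
  from assms(2) obtain d where "d > 0" "\<And>u. dist u t < d \<Longrightarrow> f t \<le> f u"
    unfolding eventually_nhds_metric by blast
  then show ?thesis using DERIV_local_min[OF ft, of d] by (auto simp: dist_real_def abs_minus_commute)
qed

text \<open>No Taylor formula is used, since the second derivative exists only at \<open>t\<close>.
  If it were negative, \<open>f'\<close> would drop below \<open>f' t = 0\<close> just to the right
  of \<open>t\<close>, and the mean value theorem would make \<open>f\<close> decrease
  there.\<close>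

lemma jet2_local_min_second:
  assumes "jet2 f t b c" "\<forall>\<^sub>F u in nhds t. f t \<le> f u"
  shows "c \<ge> 0"
proof (rule ccontr)
  assume "\<not> c \<ge> 0"
  then have c: "c < 0" by simp
  from assms(1) obtain f' where h:
    "\<forall>\<^sub>F u in nhds t. (f has_real_derivative f' u) (at u)" "f' t = b" "(f' has_real_derivative c) (at t)"
    unfolding jet2_def by blast
  have b: "b = 0" using jet2_local_min_first assms by blast
  obtain d1 where d1: "d1 > 0" "\<And>k. 0 < k \<Longrightarrow> k < d1 \<Longrightarrow> f' (t + k) < f' t"
    using DERIV_neg_dec_right[OF h(3) c] by blast
  from h(1) assms(2) have "\<forall>\<^sub>F u in nhds t. (f has_real_derivative f' u) (at u) \<and> f t \<le> f u"
    by eventually_elim simp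
  then obtain d2 where d2: "d2 > 0" "\<And>u. dist u t < d2 \<Longrightarrow> (f has_real_derivative f' u) (at u) \<and> f t \<le> f u"
    unfolding eventually_nhds_metric by blast
  define e where "e = min d1 d2 / 2"
  have e: "e > 0" "e < d1" "e < d2" using d1 d2 by (auto simp: e_def)
  have "\<exists>z>t. z < t + e \<and> f (t + e) - f t = (t + e - t) * f' z"
    by (rule MVT2) (use e d2 in \<open>auto simp: dist_real_def\<close>)
  then obtain z where z: "z > t" "z < t + e" "f (t + e) - f t = e * f' z" by auto
  have "f' z < 0" using d1(2)[of "z - t"] z e h(2) b by auto
  then have "f (t + e) < f t" using z(3) e(1) by (smt (verit) mult_pos_neg)
  moreover have "f t \<le> f (t + e)" using d2(2)[of "t + e"] e by (auto simp: dist_real_def)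
  ultimately show False by simp
qed

lemma jet2_boundary_min_first:
  assumes "jet2 f t b c" "\<forall>\<^sub>F u in nhds t. u \<ge> t \<longrightarrow> f t \<le> f u"
  shows "b \<ge> 0"
proof (rule ccontr)
  assume b: "\<not> b \<ge> 0"
  from assms(1) have ft: "(f has_real_derivative b) (at t)"
    unfolding jet2_def using eventually_nhds_x_imp_x by blast
  obtain d1 where d1: "d1 > 0" "\<And>k. 0 < k \<Longrightarrow> k < d1 \<Longrightarrow> f (t + k) < f t"
    using DERIV_neg_dec_right[OF ft] b by force
  obtain d2 where d2: "d2 > 0" "\<And>u. dist u t < d2 \<Longrightarrow> u \<ge> t \<longrightarrow> f t \<le> f u"
    using assms(2) unfolding eventually_nhds_metric by blast
  obtain e where "0 < e" "e < d1" "e < d2"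
    using d1(1) d2(1) by (metis field_lbound_gt_zero)
  then show False using d1(2)[of e] d2(2)[of "t + e"] by (auto simp: dist_real_def)
qed

text \<open>
  In terms of \<open>z\<close> with \<open>w = z\<^sup>2\<close>, the operator is \<open>\<Delta>\<^sub>x + \<partial>\<^sub>z\<^sup>2 + (\<kappa> / 2 - 1) / z \<partial>\<^sub>z\<close>.
\<close>

definition has_L :: "real \<Rightarrow> ('a::euclidean_space \<Rightarrow> real \<Rightarrow> real) \<Rightarrow> 'a \<Rightarrow> real \<Rightarrow> real \<Rightarrow> bool" where
  "has_L \<kappa> u x w v \<longleftrightarrow> (\<exists>B D e1 e2.
      (\<forall>b\<in>Basis. jet2 (\<lambda>t. u (x + t *\<^sub>R b) w) 0 (B b) (D b)) \<and> jet2 (u x) w e1 e2 \<and>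
      v = (\<Sum>b\<in>Basis. D b) + 4 * w * e2 + \<kappa> * e1)"

lemma has_LI:
  assumes "\<And>b. b \<in> Basis \<Longrightarrow> jet2 (\<lambda>t. u (x + t *\<^sub>R b) w) 0 (B b) (D b)" "jet2 (u x) w e1 e2"
    and "v = (\<Sum>b\<in>Basis. D b) + 4 * w * e2 + \<kappa> * e1"
  shows "has_L \<kappa> u x w v"
  using assms unfolding has_L_def by blast

lemma has_L_const: "has_L \<kappa> (\<lambda>_ _. k) x w 0"
  by (rule has_LI[where B = "\<lambda>_. 0" and D = "\<lambda>_. 0"]) (auto intro: jet2_const)

lemma has_L_add:
  assumes "has_L \<kappa> u x w v" "has_L \<kappa> u' x w v'"
  shows "has_L \<kappa> (\<lambda>x w. u x w + u' x w) x w (v + v')"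
proof -
  obtain B D e1 e2 where 1: "\<And>b. b \<in> Basis \<Longrightarrow> jet2 (\<lambda>t. u (x + t *\<^sub>R b) w) 0 (B b) (D b)"
    "jet2 (u x) w e1 e2" "v = (\<Sum>b\<in>Basis. D b) + 4 * w * e2 + \<kappa> * e1"
    using assms(1) unfolding has_L_def by blast
  obtain B' D' e1' e2' where 2: "\<And>b. b \<in> Basis \<Longrightarrow> jet2 (\<lambda>t. u' (x + t *\<^sub>R b) w) 0 (B' b) (D' b)"
    "jet2 (u' x) w e1' e2'" "v' = (\<Sum>b\<in>Basis. D' b) + 4 * w * e2' + \<kappa> * e1'"
    using assms(2) unfolding has_L_def by blast
  show ?thesis
    by (rule has_LI[OF jet2_add[OF 1(1) 2(1)] jet2_add[OF 1(2) 2(2)]])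
      (auto simp: 1(3) 2(3) algebra_simps sum.distrib)
qed

lemma has_L_cmult:
  assumes "has_L \<kappa> u x w v"
  shows "has_L \<kappa> (\<lambda>x w. k * u x w) x w (k * v)"
proof -
  obtain B D e1 e2 where 1: "\<And>b. b \<in> Basis \<Longrightarrow> jet2 (\<lambda>t. u (x + t *\<^sub>R b) w) 0 (B b) (D b)"
    "jet2 (u x) w e1 e2" "v = (\<Sum>b\<in>Basis. D b) + 4 * w * e2 + \<kappa> * e1"
    using assms(1) unfolding has_L_def by blast
  show ?thesis
    by (rule has_LI[OF jet2_cmult[OF 1(1)] jet2_cmult[OF 1(2)]])
      (auto simp: 1(3) algebra_simps sum_distrib_left)
qed

lemma has_L_sum:
  assumes "\<And>j. j \<in> J \<Longrightarrow> has_L \<kappa> (u j) x w (v j)"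
  shows "has_L \<kappa> (\<lambda>x w. \<Sum>j\<in>J. u j x w) x w (\<Sum>j\<in>J. v j)"
proof (cases "finite J")
  case True
  then show ?thesis using assms
    by (induction J) (auto intro!: has_L_add has_L_const)
qed (simp add: has_L_const)

text \<open>Chain rule for a base that is affine in \<open>w\<close>. The last bracket is the
  squared gradient in the variables \<open>x\<close> and \<open>z\<close>: as
  \<open>w = z\<^sup>2\<close>, the \<open>z\<close>-derivative of \<open>Q\<close> is
  \<open>2 * z * c\<close>, with square \<open>4 * w * c\<^sup>2\<close>.\<close>

lemma has_L_powr:
  assumes B: "\<And>b. b \<in> Basis \<Longrightarrow> jet2 (\<lambda>t. Q (x + t *\<^sub>R b) w) 0 (B b) (D b)"
    and c: "jet2 (Q x) w c 0" and pos: "Q x w > 0"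
  shows "has_L \<kappa> (\<lambda>x w. Q x w powr r) x w
    (r * Q x w powr (r - 1) * ((\<Sum>b\<in>Basis. D b) + \<kappa> * c) +
     r * (r - 1) * Q x w powr (r - 2) * ((\<Sum>b\<in>Basis. (B b)\<^sup>2) + 4 * w * c\<^sup>2))"
proof (rule has_LI)
  show "jet2 (\<lambda>t. Q (x + t *\<^sub>R b) w powr r) 0 (r * Q x w powr (r - 1) * B b)
     (r * (r - 1) * Q x w powr (r - 2) * (B b)\<^sup>2 + r * Q x w powr (r - 1) * D b)"
    if "b \<in> Basis" for b
    using jet2_powr[OF B[OF that], of r] pos by simp
  show "jet2 (\<lambda>v. Q x v powr r) w (r * Q x w powr (r - 1) * c)
     (r * (r - 1) * Q x w powr (r - 2) * c\<^sup>2 + r * Q x w powr (r - 1) * 0)"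
    using jet2_powr[OF c pos, of r] .
  have "(\<Sum>b\<in>Basis. r * (r - 1) * Q x w powr (r - 2) * (B b)\<^sup>2 + r * Q x w powr (r - 1) * D b) =
      r * (r - 1) * Q x w powr (r - 2) * (\<Sum>b\<in>Basis. (B b)\<^sup>2) + r * Q x w powr (r - 1) * (\<Sum>b\<in>Basis. D b)"
    by (simp add: sum.distrib sum_distrib_left)
  then show "r * Q x w powr (r - 1) * ((\<Sum>b\<in>Basis. D b) + \<kappa> * c) +
     r * (r - 1) * Q x w powr (r - 2) * ((\<Sum>b\<in>Basis. (B b)\<^sup>2) + 4 * w * c\<^sup>2) =
     (\<Sum>b\<in>Basis. r * (r - 1) * Q x w powr (r - 2) * (B b)\<^sup>2 + r * Q x w powr (r - 1) * D b) +
     4 * w * (r * (r - 1) * Q x w powr (r - 2) * c\<^sup>2 + r * Q x w powr (r - 1) * 0) +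
     \<kappa> * (r * Q x w powr (r - 1) * c)"
    by (simp add: algebra_simps)
qed

text \<open>
  At \<open>w = 0\<close> the term with the second \<open>w\<close>-derivative vanishes and only the one-sided sign of the
  first one is known; this is where \<open>\<kappa> \<ge> 0\<close> enters.
\<close>

lemma has_L_min:
  fixes x :: "'a::euclidean_space"
  assumes "has_L \<kappa> u x w v" "\<kappa> \<ge> 0" "w \<ge> 0"
    and "\<And>b. b \<in> Basis \<Longrightarrow> \<forall>\<^sub>F t in nhds 0. u x w \<le> u (x + t *\<^sub>R b) w"
    and "\<forall>\<^sub>F y in nhds w. y \<ge> 0 \<longrightarrow> u x w \<le> u x y"
  shows "v \<ge> 0"
proof -
  obtain B D e1 e2 where 1: "\<And>b. b \<in> Basis \<Longrightarrow> jet2 (\<lambda>t. u (x + t *\<^sub>R b) w) 0 (B b) (D b)"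
    "jet2 (u x) w e1 e2" "v = (\<Sum>b\<in>Basis. D b) + 4 * w * e2 + \<kappa> * e1"
    using assms(1) unfolding has_L_def by blast
  have D: "D b \<ge> 0" if "b \<in> Basis" for b
    using jet2_local_min_second[OF 1(1)[OF that]] assms(4)[OF that] by simp
  have "w * e2 \<ge> 0 \<and> \<kappa> * e1 \<ge> 0"
  proof (cases "w = 0")
    case True
    then have "e1 \<ge> 0" using jet2_boundary_min_first[OF 1(2)] assms(5) by simp
    then show ?thesis using True assms(2) by simp
  next
    case False
    then have "w > 0" using assms by simp
    then have "\<forall>\<^sub>F y in nhds w. y > 0"
      by (intro eventually_nhds_in_open[of "{0<..}", simplified]) auto
    with assms(5) have "\<forall>\<^sub>F y in nhds w. u x w \<le> u x y" by eventually_elim auto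
    then show ?thesis
      using jet2_local_min_first[OF 1(2)] jet2_local_min_second[OF 1(2)] assms(3) by simp
  qed
  then show ?thesis using 1(3) sum_nonneg[of Basis D] D by fastforce
qed

section \<open>The squared distance and the Riesz kernel under the operator\<close>

lemma jet2_quadratic: "jet2 (\<lambda>t. k + t * b + t\<^sup>2) 0 b 2"
  by (rule jet2I[where f' = "\<lambda>t. b + 2 * t"]) (auto intro!: derivative_eq_intros always_eventually)

lemma jet2_normsq:
  fixes x a :: "'a::euclidean_space"
  assumes "b \<in> Basis"
  shows "jet2 (\<lambda>t. (norm (x + t *\<^sub>R b - a))\<^sup>2 + w) 0 (2 * ((x - a) \<bullet> b)) 2"
proof -
  have "(\<lambda>t. (norm (x + t *\<^sub>R b - a))\<^sup>2 + w) = (\<lambda>t. ((norm (x - a))\<^sup>2 + w) + t * (2 * ((x - a) \<bullet> b)) + t\<^sup>2)"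
  proof
    fix t
    have *: "x + t *\<^sub>R b - a = (x - a) + t *\<^sub>R b" by simp
    show "(norm (x + t *\<^sub>R b - a))\<^sup>2 + w = ((norm (x - a))\<^sup>2 + w) + t * (2 * ((x - a) \<bullet> b)) + t\<^sup>2"
      using assms unfolding power2_norm_eq_inner *
      by (simp add: inner_add_left[of "x - a"] inner_add_right[of _ "x - a"] inner_commute[of b "x - a"] power2_eq_square ring_distribs
          del: inner_diff_left inner_diff_right)
  qed
  then show ?thesis using jet2_quadratic by simp
qed

lemma jet2_shift: "jet2 (\<lambda>v. k + v) w 1 0"
  using jet2_add[OF jet2_const jet2_ident] by simp

lemma has_L_normsq:
  fixes x a :: "'a::euclidean_space" and \<kappa> :: real
  shows "has_L \<kappa> (\<lambda>x w. (norm (x - a))\<^sup>2 + w) x w (2 * DIM('a) + \<kappa>)"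
  by (rule has_LI[OF jet2_normsq jet2_shift]) auto

text \<open>The part of the operator in \<open>z\<close> is the radial Laplacian in dimension
  \<open>\<kappa> / 2\<close>. The choice of \<open>\<kappa>\<close> makes the total effective
  dimension equal to \<open>s + 2\<close>, where the fundamental solution is the distance to the
  power -s.\<close>

lemma has_L_kernel:
  fixes x a :: "'a::euclidean_space" and s :: real
  assumes "\<kappa> = 2 * (s + 2 - DIM('a))" "(norm (x - a))\<^sup>2 + w > 0"
  shows "has_L \<kappa> (\<lambda>x w. ((norm (x - a))\<^sup>2 + w) powr (- s / 2)) x w 0"
proof -
  let ?Q = "(norm (x - a))\<^sup>2 + w" and ?r = "- s / 2"
  have "(\<Sum>b\<in>Basis. (2 * ((x - a) \<bullet> b))\<^sup>2) = 4 * (norm (x - a))\<^sup>2"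
    unfolding power2_norm_eq_inner euclidean_inner[of "x - a" "x - a"]
    by (simp add: sum_distrib_left power2_eq_square algebra_simps)
  moreover have "?Q powr (?r - 1) = ?Q powr (?r - 2) * ?Q"
  proof -
    have "?r - 1 = (?r - 2) + 1" by simp
    then show ?thesis using assms(2) by (simp only: powr_add) simp
  qed
  ultimately have "?r * ?Q powr (?r - 1) * ((\<Sum>b\<in>(Basis::'a set). 2) + \<kappa> * 1) +
     ?r * (?r - 1) * ?Q powr (?r - 2) * ((\<Sum>b\<in>(Basis::'a set). (2 * ((x - a) \<bullet> b))\<^sup>2) + 4 * w * 1\<^sup>2) = 0"
    unfolding assms(1) by (simp add: field_simps)
  then show ?thesis
    using has_L_powr[OF jet2_normsq jet2_shift assms(2), where r = ?r and \<kappa> = \<kappa>] by (simp only:)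
qed

section \<open>A minimum principle for extended Riesz potentials\<close>

definition riesz_potential :: "'j set \<Rightarrow> ('j \<Rightarrow> 'a::euclidean_space) \<Rightarrow> real \<Rightarrow> 'a \<Rightarrow> real \<Rightarrow> real" where
  "riesz_potential J a s x w = (\<Sum>j\<in>J. ((norm (x - a j))\<^sup>2 + w) powr (- s / 2))"

text \<open>In the variables \<open>x\<close> and \<open>z\<close> with \<open>w = z\<^sup>2\<close>
  this is a closed half ball about \<open>(p, 0)\<close>; \<open>R\<close> is the square of its
  radius.\<close>

definition half_ball :: "'a::euclidean_space \<Rightarrow> real \<Rightarrow> ('a \<times> real) set" where
  "half_ball p R = {X. 0 \<le> snd X \<and> (norm (fst X - p))\<^sup>2 + snd X \<le> R}"

lemma compact_half_ball: "compact (half_ball p R)"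
proof -
  have "half_ball p R = (cball p (sqrt R) \<times> {0..R}) \<inter>
      ({X. 0 \<le> snd X} \<inter> {X. (norm (fst X - p))\<^sup>2 + snd X \<le> R})"
    by (auto simp: half_ball_def dist_norm norm_minus_commute intro!: real_le_rsqrt)
      (smt (verit) zero_le_power2)
  moreover have "compact \<dots>"
    by (intro compact_Int_closed compact_Times compact_cball compact_Icc closed_Int closed_Collect_le continuous_intros)
  ultimately show ?thesis by simp
qed

text \<open>At a negative minimum of the potential minus \<open>g\<close> the operator would be
  nonnegative by \<open>has_L_min\<close>; but it is the negative of a positive value for
  \<open>g\<close>, because the potential is a solution off its poles. Points of
  \<open>w = 0\<close> outside \<open>E\<close> count as interior: the comparison is assumed only on
  the sphere and over \<open>E\<close>.\<close>

lemma min_principle: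
  fixes p :: "'a::euclidean_space" and a :: "'j \<Rightarrow> 'a" and s :: real
  assumes J: "finite J" and s: "s > 0" and \<kappa>: "\<kappa> = 2 * (s + 2 - DIM('a))" "\<kappa> \<ge> 0"
    and cont: "continuous_on (half_ball p R) (\<lambda>X. g (fst X) (snd X))"
    and sub: "\<And>x w. \<lbrakk>0 \<le> w; (norm (x - p))\<^sup>2 + w < R; x \<notin> E \<or> 0 < w\<rbrakk> \<Longrightarrow> \<exists>v>0. has_L \<kappa> g x w v"
    and bd: "\<And>x w. \<lbrakk>0 \<le> w; (norm (x - p))\<^sup>2 + w \<le> R; (norm (x - p))\<^sup>2 + w = R \<or> x \<in> E \<and> w = 0;
       x \<notin> a ` J \<or> 0 < w\<rbrakk> \<Longrightarrow> g x w \<le> riesz_potential J a s x w"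
    and X: "0 \<le> w" "(norm (x - p))\<^sup>2 + w \<le> R" "x \<notin> a ` J \<or> 0 < w"
  shows "g x w \<le> riesz_potential J a s x w"
proof (rule ccontr)
  assume neg: "\<not> g x w \<le> riesz_potential J a s x w"
  have "bounded ((\<lambda>X. g (fst X) (snd X)) ` half_ball p R)"
    by (intro compact_imp_bounded compact_continuous_image cont compact_half_ball)
  then obtain M where M: "M > 0" "\<And>X. X \<in> half_ball p R \<Longrightarrow> g (fst X) (snd X) \<le> M"
    by (fastforce simp: bounded_pos)
  \<comment> \<open>A single kernel with base at most \<open>\<eta>\<close> already reaches the
    bound \<open>M\<close> of \<open>g\<close>. So a point where the potential lies below
    \<open>g\<close> cannot be that close to a pole.\<close>
  define \<eta> where "\<eta> = M powr (- 2 / s)"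
  have \<eta>: "\<eta> > 0" "\<eta> powr (- s / 2) = M" using M s by (auto simp: \<eta>_def powr_powr)
  have large: "(norm (y - a j))\<^sup>2 + v > \<eta>" if "y \<notin> a ` J \<or> 0 < v" "0 \<le> v" "(y, v) \<in> half_ball p R"
      "riesz_potential J a s y v < g y v" "j \<in> J" for y v j
  proof (rule ccontr)
    assume *: "\<not> \<eta> < (norm (y - a j))\<^sup>2 + v"
    have pos: "(norm (y - a j))\<^sup>2 + v > 0"
    proof (cases "v > 0")
      case False
      then have "y \<noteq> a j" using that by auto
      then show ?thesis using that(2) by (simp add: add_pos_nonneg)
    qed (simp add: add_nonneg_pos)
    have "M \<le> ((norm (y - a j))\<^sup>2 + v) powr (- s / 2)"
      using \<eta> * pos s by (metis divide_neg_pos less_eq_real_def linorder_not_le neg_less_0_iff_less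
          powr_mono2' zero_less_numeral)
    also have "\<dots> \<le> riesz_potential J a s y v"
      unfolding riesz_potential_def using J that(5) by (intro member_le_sum) auto
    also have "\<dots> < M" using M(2)[OF that(3)] that(4) by simp
    finally show False by simp
  qed
  \<comment> \<open>Cutting out the poles leaves a compact set on which the difference is continuous
    and which still contains the supposed counterexample.\<close>
  define K where "K = half_ball p R \<inter> (\<Inter>j\<in>J. {X. \<eta> \<le> (norm (fst X - a j))\<^sup>2 + snd X})"
  define f where "f X = riesz_potential J a s (fst X) (snd X) - g (fst X) (snd X)" for X
  have "compact K" unfolding K_def
    by (intro compact_Int_closed compact_half_ball closed_INT ballI closed_Collect_le continuous_intros)
  moreover have xK: "(x, w) \<in> K"
    using large[of x w] X neg by (auto simp: K_def half_ball_def intro: less_imp_le)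
  moreover have "continuous_on K f" unfolding f_def riesz_potential_def
    by (intro continuous_intros continuous_on_subset[OF cont]) (use \<eta>(1) in \<open>force simp: K_def\<close>)+
  ultimately obtain X0 where X0: "X0 \<in> K" "\<And>X. X \<in> K \<Longrightarrow> f X0 \<le> f X"
    using continuous_attains_inf[of K f] by blast
  obtain y v where yv: "X0 = (y, v)" by (cases X0)
  have fneg: "riesz_potential J a s y v < g y v" using X0(2)[OF xK] neg by (simp add: f_def yv)
  have hb: "(y, v) \<in> half_ball p R" and v0: "v \<ge> 0" using X0(1) by (auto simp: K_def yv half_ball_def)
  have np: "y \<notin> a ` J \<or> 0 < v" using X0(1) \<eta>(1) v0 by (force simp: K_def yv)
  have nbd: "\<not> ((norm (y - p))\<^sup>2 + v = R \<or> y \<in> E \<and> v = 0)"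
    using bd[of v y] v0 hb np fneg by (auto simp: half_ball_def)
  then have int: "(norm (y - p))\<^sup>2 + v < R" "y \<notin> E \<or> 0 < v" using hb v0 by (auto simp: half_ball_def)
  obtain c where c: "c > 0" "has_L \<kappa> g y v c" using sub[OF v0 int] by blast
  \<comment> \<open>The strict versions of the constraints give an open set around the minimizer.
    Within it only \<open>snd X \<ge> 0\<close> restricts the competitors, as in the one-sided test
    of \<open>has_L_min\<close>.\<close>
  define Op where "Op = {X. (norm (fst X - p))\<^sup>2 + snd X < R} \<inter>
      (\<Inter>j\<in>J. {X. \<eta> < (norm (fst X - a j))\<^sup>2 + snd X})"
  have opn: "open Op" unfolding Op_def
    by (intro open_Int open_INT J ballI open_Collect_less continuous_intros)
  have inO: "(y, v) \<in> Op" using int(1) large[OF np v0 hb fneg] by (auto simp: Op_def)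
  have OK: "f (y, v) \<le> f X" if "X \<in> Op" "snd X \<ge> 0" for X
    using X0(2)[of X] that by (auto simp: Op_def K_def yv half_ball_def intro: less_imp_le)
  have ker: "has_L \<kappa> (\<lambda>x w. ((norm (x - a j))\<^sup>2 + w) powr (- s / 2)) y v 0" if "j \<in> J" for j
    using has_L_kernel[OF \<kappa>(1)] large[OF np v0 hb fneg that] \<eta>(1) by simp
  have "has_L \<kappa> (\<lambda>x w. riesz_potential J a s x w + (- 1) * g x w) y v ((\<Sum>j\<in>J. 0) + (- 1) * c)"
    unfolding riesz_potential_def by (intro has_L_add has_L_sum has_L_cmult ker c)
  then have hL: "has_L \<kappa> (\<lambda>x w. f (x, w)) y v (- c)" by (simp add: f_def)
  have ev: "\<forall>\<^sub>F t in nhds t0. h t \<in> Op" if "h t0 = (y, v)" "continuous_on UNIV h" for h :: "real \<Rightarrow> _" and t0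
  proof -
    have "(h \<longlongrightarrow> h t0) (nhds t0)"
      using that(2) by (metis UNIV_I continuous_on_def tendsto_at_iff_tendsto_nhds)
    then show ?thesis using topological_tendstoD[OF _ opn] that(1) inO by metis
  qed
  have "- c \<ge> 0"
  proof (rule has_L_min[OF hL \<kappa>(2) v0])
    fix b :: 'a
    show "\<forall>\<^sub>F t in nhds 0. f (y, v) \<le> f (y + t *\<^sub>R b, v)"
    proof (rule eventually_mono[OF ev])
      show "continuous_on UNIV (\<lambda>t. (y + t *\<^sub>R b, v))" by (intro continuous_intros)
    qed (use OK v0 in auto)
  next
    show "\<forall>\<^sub>F t in nhds v. t \<ge> 0 \<longrightarrow> f (y, v) \<le> f (y, t)"
    proof (rule eventually_mono[OF ev])
      show "continuous_on UNIV (\<lambda>t. (y, t))" by (intro continuous_intros)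
    qed (use OK in auto)
  qed
  then show False using c by simp
qed

section \<open>Barriers near a level set\<close>

text \<open>
  With \<open>G = |\<nabla>F|\<^sup>2\<close>, the function \<open>F\<^sup>2 + G w\<close> is to leading order \<open>G\<close> times the squared distance to
  \<open>{F = 0} \<times> {0}\<close>. Multiplying \<open>w\<close> by \<open>G\<close> instead of dividing \<open>F\<close> by \<open>|\<nabla>F|\<close> keeps the computation
  polynomial.
\<close>

lemma has_L_defining_powr:
  fixes F G :: "'a::euclidean_space \<Rightarrow> real"
  assumes F: "\<And>b. b \<in> Basis \<Longrightarrow> jet2 (\<lambda>t. F (x + t *\<^sub>R b)) 0 (F1 b) (F2 b)"
    and G: "\<And>b. b \<in> Basis \<Longrightarrow> jet2 (\<lambda>t. G (x + t *\<^sub>R b)) 0 (G1 b) (G2 b)"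
    and grad: "G x = (\<Sum>b\<in>Basis. (F1 b)\<^sup>2)"
    and q: "q = (F x)\<^sup>2 + G x * w" "q > 0"
  shows "has_L \<kappa> (\<lambda>x w. ((F x)\<^sup>2 + G x * w) powr \<gamma>) x w
    (\<gamma> * q powr (\<gamma> - 1) * ((\<kappa> - 2 + 4 * \<gamma>) * G x + (2 * F x * (\<Sum>b\<in>Basis. F2 b) + w * (\<Sum>b\<in>Basis. G2 b) +
       (\<gamma> - 1) * (4 * w * F x * (\<Sum>b\<in>Basis. F1 b * G1 b) + w\<^sup>2 * (\<Sum>b\<in>Basis. (G1 b)\<^sup>2)) / q)))"
proof -
  let ?B = "\<lambda>b. 2 * F x * F1 b + w * G1 b"
  let ?D = "\<lambda>b. 2 * (F1 b)\<^sup>2 + 2 * F x * F2 b + w * G2 b"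
  have 1: "jet2 (\<lambda>t. (F (x + t *\<^sub>R b))\<^sup>2 + G (x + t *\<^sub>R b) * w) 0 (?B b) (?D b)" if b: "b \<in> Basis" for b
    using jet2_add[OF jet2_mult[OF F[OF b] F[OF b]] jet2_cmult[OF G[OF b], of w]]
    by (simp add: power2_eq_square algebra_simps)
  have 2: "jet2 (\<lambda>w. (F x)\<^sup>2 + G x * w) w (G x) 0"
    using jet2_add[OF jet2_const jet2_cmult[OF jet2_ident]] by simp
  have D: "(\<Sum>b\<in>Basis. ?D b) = 2 * G x + 2 * F x * (\<Sum>b\<in>Basis. F2 b) + w * (\<Sum>b\<in>Basis. G2 b)"
    by (simp add: grad sum.distrib sum_distrib_left)
  have B: "(\<Sum>b\<in>Basis. (?B b)\<^sup>2) = 4 * (F x)\<^sup>2 * G x + 4 * w * F x * (\<Sum>b\<in>Basis. F1 b * G1 b) + w\<^sup>2 * (\<Sum>b\<in>Basis. (G1 b)\<^sup>2)"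
    by (simp add: grad sum.distrib sum_distrib_left power2_eq_square algebra_simps)
  define P where "P = (\<Sum>b\<in>Basis. F1 b * G1 b)"
  define R where "R = (\<Sum>b\<in>Basis. (G1 b)\<^sup>2)"
  have pw: "q powr (\<gamma> - 2) = q powr (\<gamma> - 1) / q"
    using q(2) by (simp add: powr_diff[of q "\<gamma> - 1" 1, simplified])
  \<comment> \<open>Since \<open>G\<close> is the squared gradient of \<open>F\<close>, the leading
    terms \<open>4 * (F x)\<^sup>2 * G x\<close> and \<open>4 * w * (G x)\<^sup>2\<close> combine to
    \<open>4 * G x * q\<close>; what remains contains derivatives of \<open>G\<close>.\<close>
  have "(\<Sum>b\<in>Basis. (?B b)\<^sup>2) + 4 * w * (G x)\<^sup>2 = 4 * G x * q + (4 * w * F x * P + w\<^sup>2 * R)"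
    unfolding B by (simp add: q(1) P_def R_def algebra_simps power2_eq_square)
  then have e: "\<gamma> * (\<gamma> - 1) * q powr (\<gamma> - 2) * ((\<Sum>b\<in>Basis. (?B b)\<^sup>2) + 4 * w * (G x)\<^sup>2) =
    \<gamma> * q powr (\<gamma> - 1) * ((\<gamma> - 1) * 4 * G x + (\<gamma> - 1) * (4 * w * F x * P + w\<^sup>2 * R) / q)"
    unfolding pw using q(2) by (simp add: field_simps)
  show ?thesis
    using has_L_powr[where Q = "\<lambda>x w. (F x)\<^sup>2 + G x * w", OF 1 2, where \<kappa> = \<kappa> and r = \<gamma>] q
    unfolding D q(1)[symmetric] e P_def[symmetric] R_def[symmetric]
    by (simp add: algebra_simps)
qed

text \<open>The letters \<open>S\<close>, \<open>T\<close>, \<open>P\<close>, \<open>R\<close> stand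
  for the four sums in \<open>has_L_defining_powr\<close>. As
  \<open>\<bar>F\<bar> \<le> sqrt q\<close> and \<open>w \<le> q / c\<close>, every term is of order
  \<open>sqrt q\<close>. The constant is 8 = 2 + 1 + 4 + 1, and \<open>c \<le> 1\<close> lets
  \<open>1 / c\<^sup>2\<close> dominate both 1 and \<open>1 / c\<close>.\<close>

lemma defining_error_bound:
  fixes F G w q S T P R C c \<gamma> :: real
  assumes q: "q = F\<^sup>2 + G * w" "0 < q" "q \<le> 1" and c: "0 < c" "c \<le> 1" "c \<le> G" and w: "0 \<le> w"
    and bd: "\<bar>S\<bar> \<le> C" "\<bar>T\<bar> \<le> C" "\<bar>P\<bar> \<le> C" "\<bar>R\<bar> \<le> C" and \<gamma>: "0 \<le> \<gamma>" "\<gamma> \<le> 1"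
  shows "\<bar>2 * F * S + w * T + (\<gamma> - 1) * (4 * w * F * P + w\<^sup>2 * R) / q\<bar> \<le> 8 * C / c\<^sup>2 * sqrt q"
proof -
  have C: "C \<ge> 0" using bd(1) by linarith
  have Gw: "G * w \<ge> c * w" by (rule mult_right_mono) (use c w in auto)
  then have F: "\<bar>F\<bar> \<le> sqrt q" using q w c by (intro real_le_rsqrt) (auto simp: mult_nonneg_nonneg)
  have wq: "w \<le> q / c" using Gw q c by (simp add: field_simps) (smt (verit) zero_le_power2)
  have "q * q \<le> q" using q by (simp add: mult_left_le)
  then have sq: "q \<le> sqrt q" by (intro real_le_rsqrt) (simp add: power2_eq_square)
  have c2: "1 / c \<le> 1 / c\<^sup>2" "1 \<le> 1 / c\<^sup>2" using c by (auto simp: field_simps power2_eq_square mult_le_one mult_left_le)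
  define k where "k = 1 / c\<^sup>2"
  have k: "1 \<le> k" "1 / c \<le> k" using c2 by (auto simp: k_def)
  have s0: "sqrt q \<ge> 0" using q by simp
  have wk: "w \<le> k * sqrt q"
  proof -
    have "w \<le> 1 / c * q" using wq by simp
    also have "\<dots> \<le> k * sqrt q" by (rule mult_mono) (use k sq q c in auto)
    finally show ?thesis .
  qed
  have t1: "\<bar>2 * F * S\<bar> \<le> 2 * (k * sqrt q * C)"
  proof -
    have "\<bar>F\<bar> * \<bar>S\<bar> \<le> (1 * sqrt q) * C" by (rule mult_mono) (use F bd s0 in simp_all)
    also have "\<dots> \<le> (k * sqrt q) * C" by (intro mult_right_mono) (use k s0 C in auto)
    finally show ?thesis by (simp add: abs_mult)
  qed
  have t2: "\<bar>w * T\<bar> \<le> k * sqrt q * C"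
    unfolding abs_mult by (rule mult_mono) (use wk w bd s0 k in simp_all)
  have wFq: "w / q * \<bar>F\<bar> \<le> k * sqrt q"
  proof -
    have "w / q \<le> 1 / c" using wq q c by (simp add: field_simps)
    then have wk': "w / q \<le> k" using k by linarith
    show ?thesis by (rule mult_mono[OF wk' F]) (use k in simp_all)
  qed
  have t3: "\<bar>4 * w * F * P / q\<bar> \<le> 4 * (k * sqrt q * C)"
  proof -
    have "(w / q * \<bar>F\<bar>) * \<bar>P\<bar> \<le> (k * sqrt q) * C" by (rule mult_mono[OF wFq bd(3)]) (use s0 k in simp_all)
    moreover have "\<bar>4 * w * F * P / q\<bar> = 4 * ((w / q * \<bar>F\<bar>) * \<bar>P\<bar>)" using w q(2) by (simp add: abs_mult)
    ultimately show ?thesis by simp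
  qed
  have wwq: "w / q * w \<le> k * sqrt q"
  proof -
    have wc: "w / q \<le> 1 / c" using wq q c by (simp add: field_simps)
    have "w / q * w \<le> 1 / c * (1 / c * q)" by (rule mult_mono[OF wc]) (use wq w c in simp_all)
    also have "\<dots> = k * q" by (simp add: k_def power2_eq_square)
    also have "\<dots> \<le> k * sqrt q" by (rule mult_left_mono) (use k sq in auto)
    finally show ?thesis .
  qed
  have t4: "\<bar>w\<^sup>2 * R / q\<bar> \<le> k * sqrt q * C"
  proof -
    have "(w / q * w) * \<bar>R\<bar> \<le> (k * sqrt q) * C" by (rule mult_mono[OF wwq bd(4)]) (use s0 k in simp_all)
    moreover have "\<bar>w\<^sup>2 * R / q\<bar> = (w / q * w) * \<bar>R\<bar>" using w q(2) by (simp add: abs_mult power2_eq_square)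
    ultimately show ?thesis by simp
  qed
  have "\<bar>(\<gamma> - 1) * (4 * w * F * P + w\<^sup>2 * R) / q\<bar> \<le> 1 * \<bar>(4 * w * F * P + w\<^sup>2 * R) / q\<bar>"
    unfolding times_divide_eq_right[symmetric] abs_mult by (rule mult_right_mono) (use \<gamma> in auto)
  also have "\<dots> \<le> \<bar>4 * w * F * P / q\<bar> + \<bar>w\<^sup>2 * R / q\<bar>"
    unfolding add_divide_distrib mult_1 by (rule abs_triangle_ineq)
  finally have t34: "\<bar>(\<gamma> - 1) * (4 * w * F * P + w\<^sup>2 * R) / q\<bar> \<le> 5 * (k * sqrt q * C)"
    using t3 t4 by linarith
  have "\<bar>x + y + z\<bar> \<le> 8 * D" if "\<bar>x\<bar> \<le> 2 * D" "\<bar>y\<bar> \<le> D" "\<bar>z\<bar> \<le> 5 * D" for x y z D :: real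
    using that by linarith
  from this[OF t1 t2 t34]
  have "\<bar>2 * F * S + w * T + (\<gamma> - 1) * (4 * w * F * P + w\<^sup>2 * R) / q\<bar> \<le> 8 * (k * sqrt q * C)" .
  also have "8 * (k * sqrt q * C) = 8 * C / c\<^sup>2 * sqrt q" by (simp add: k_def)
  finally show ?thesis .
qed

text \<open>Here \<open>e\<close> and \<open>e'\<close> are the errors for the exponents
  \<open>\<gamma>\<close> and \<open>\<gamma> + 1/4\<close>. The first term is of order
  \<open>q powr (\<gamma> - 1/2)\<close>, the subtracted one of order
  \<open>q powr (\<gamma> - 3/4)\<close>, so the latter wins for small \<open>q\<close>. Its power
  of \<open>q\<close> is at least 1 because \<open>q \<le> 1\<close>, which gives a margin
  independent of \<open>q\<close>.\<close>

lemma barrier_bulk_negative: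
  fixes q c C G e e' \<gamma> :: real
  assumes q: "0 < q" "q \<le> 1" "C * q powr (1/4) \<le> c / 8" and c: "0 < c" "c \<le> G" and C: "C \<ge> 0"
    and e: "\<bar>e\<bar> \<le> C * sqrt q" "\<bar>e'\<bar> \<le> C * sqrt q" and \<gamma>: "0 < \<gamma>" "\<gamma> \<le> 1 / 2"
  shows "\<gamma> * q powr (\<gamma> - 1) * e - (\<gamma> + 1/4) * q powr (\<gamma> + 1/4 - 1) * (G + e') \<le> - c / 16"
proof -
  let ?P = "q powr (\<gamma> - 3/4)"
  have P: "?P \<ge> 1" using q \<gamma> powr_mono'[of "\<gamma> - 3/4" 0 q] by simp
  have s: "sqrt q = q powr (1/4) * q powr (1/4)" using q by (simp add: powr_half_sqrt flip: powr_add)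
  have q4: "q powr (1/4) \<le> 1" using q by (simp add: powr_le1)
  have a: "q powr (\<gamma> - 1) * sqrt q = ?P * q powr (1/4)"
    using q by (simp add: powr_half_sqrt[symmetric] flip: powr_add)
  have "C * sqrt q \<le> c / 8 * 1" unfolding s mult.assoc[symmetric]
    by (rule mult_mono) (use q q4 c in auto)
  then have Ge: "G + e' \<ge> c / 2" using e c by linarith
  have "(\<gamma> + 1/4) * ?P * (G + e') \<ge> (1/4) * ?P * (c / 2)"
    by (intro mult_mono) (use Ge \<gamma> P c in auto)
  moreover have "\<gamma> * q powr (\<gamma> - 1) * e \<le> ?P * (c / 16)"
  proof -
    have "\<gamma> * q powr (\<gamma> - 1) * e \<le> \<gamma> * q powr (\<gamma> - 1) * (C * sqrt q)"
      by (rule mult_left_mono) (use \<gamma> e in auto)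
    also have "\<dots> \<le> 1 / 2 * q powr (\<gamma> - 1) * (C * sqrt q)"
      by (rule mult_right_mono) (use \<gamma> C q in auto)
    also have "\<dots> = 1 / 2 * ?P * (C * q powr (1/4))" using a by (simp add: algebra_simps)
    also have "\<dots> \<le> 1 / 2 * ?P * (c / 8)" by (rule mult_left_mono) (use q in auto)
    finally show ?thesis by simp
  qed
  ultimately have "\<gamma> * q powr (\<gamma> - 1) * e - (\<gamma> + 1/4) * ?P * (G + e') \<le> - (?P * (c / 16))"
    by linarith
  also have "\<dots> \<le> - (1 * (c / 16))" using P c by (intro le_imp_neg_le mult_right_mono) auto
  finally show ?thesis by (simp add: algebra_simps)
qed

lemma power_powr:
  fixes x :: real
  assumes "x > 0"
  shows "(x ^ n) powr r = x powr (n * r)"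
  using assms by (simp add: powr_powr flip: powr_realpow)

text \<open>
  For \<open>\<kappa> = 2 - 4 \<gamma>\<close> the leading term of \<open>L (q\<^sup>\<gamma>)\<close> vanishes. Subtracting \<open>q\<close> to a slightly larger power
  makes the result strictly superharmonic, with a margin that absorbs the quadratic term needed to
  reach \<open>1\<close> on the sphere.
\<close>

lemma barrier_exists:
  fixes F G :: "'a::euclidean_space \<Rightarrow> real" and p0 :: 'a and F1 F2 G1 G2 :: "'a \<Rightarrow> 'a \<Rightarrow> real"
  assumes \<delta>0: "\<delta>0 > 0"
    and F: "\<And>x b. x \<in> cball p0 \<delta>0 \<Longrightarrow> b \<in> Basis \<Longrightarrow> jet2 (\<lambda>t. F (x + t *\<^sub>R b)) 0 (F1 b x) (F2 b x)"
    and G: "\<And>x b. x \<in> cball p0 \<delta>0 \<Longrightarrow> b \<in> Basis \<Longrightarrow> jet2 (\<lambda>t. G (x + t *\<^sub>R b)) 0 (G1 b x) (G2 b x)"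
    and cont: "continuous_on (cball p0 \<delta>0) F" "continuous_on (cball p0 \<delta>0) G"
      "\<And>b. b \<in> Basis \<Longrightarrow> continuous_on (cball p0 \<delta>0) (F1 b)"
      "\<And>b. b \<in> Basis \<Longrightarrow> continuous_on (cball p0 \<delta>0) (F2 b)"
      "\<And>b. b \<in> Basis \<Longrightarrow> continuous_on (cball p0 \<delta>0) (G1 b)"
      "\<And>b. b \<in> Basis \<Longrightarrow> continuous_on (cball p0 \<delta>0) (G2 b)"
    and grad: "\<And>x. x \<in> cball p0 \<delta>0 \<Longrightarrow> G x = (\<Sum>b\<in>Basis. (F1 b x)\<^sup>2)"
    and Gpos: "\<And>x. x \<in> cball p0 \<delta>0 \<Longrightarrow> G x > 0"
    and lip: "\<And>x y. x \<in> cball p0 \<delta>0 \<Longrightarrow> y \<in> cball p0 \<delta>0 \<Longrightarrow> \<bar>F x - F y\<bar> \<le> B * norm (x - y)"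
    and \<gamma>: "0 < \<gamma>" "\<gamma> \<le> 1 / 2" and \<kappa>: "\<kappa> = 2 - 4 * \<gamma>"
  shows "\<exists>\<delta>>0. \<exists>K>0. \<forall>p\<in>cball p0 \<delta>. F p = 0 \<longrightarrow> cball p \<delta> \<subseteq> cball p0 \<delta>0 \<and> (\<exists>h.
     continuous_on (half_ball p (\<delta>\<^sup>2)) (\<lambda>X. h (fst X) (snd X)) \<and>
     (\<forall>x w. (x, w) \<in> half_ball p (\<delta>\<^sup>2) \<and> (F x \<noteq> 0 \<or> 0 < w) \<longrightarrow> (\<exists>v<0. has_L \<kappa> h x w v)) \<and>
     (\<forall>x w. (x, w) \<in> half_ball p (\<delta>\<^sup>2) \<longrightarrow> 0 \<le> h x w \<and> h x w \<le> K * ((norm (x - p))\<^sup>2 + w) powr \<gamma> \<and>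
        ((norm (x - p))\<^sup>2 + w = \<delta>\<^sup>2 \<longrightarrow> 1 \<le> h x w)))"
proof -
  let ?S = "cball p0 \<delta>0"
  have bdd: "\<exists>C. \<forall>x\<in>?S. \<bar>f x\<bar> \<le> C" if "continuous_on ?S f" for f :: "'a \<Rightarrow> real"
    using compact_imp_bounded[OF compact_continuous_image[OF that compact_cball]]
    by (auto simp: bounded_iff)
  have C15: "\<exists>C. \<forall>x\<in>?S. \<bar>\<Sum>b\<in>Basis. F2 b x\<bar> \<le> C" "\<exists>C. \<forall>x\<in>?S. \<bar>\<Sum>b\<in>Basis. G2 b x\<bar> \<le> C"
    "\<exists>C. \<forall>x\<in>?S. \<bar>\<Sum>b\<in>Basis. F1 b x * G1 b x\<bar> \<le> C" "\<exists>C. \<forall>x\<in>?S. \<bar>\<Sum>b\<in>Basis. (G1 b x)\<^sup>2\<bar> \<le> C"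
    "\<exists>C. \<forall>x\<in>?S. \<bar>G x\<bar> \<le> C"
    by (rule bdd, intro continuous_intros cont, (assumption+)?)+
  obtain C1 where C1': "\<And>x. x \<in> ?S \<Longrightarrow> \<bar>\<Sum>b\<in>Basis. F2 b x\<bar> \<le> C1" using C15(1) by blast
  obtain C2 where C2': "\<And>x. x \<in> ?S \<Longrightarrow> \<bar>\<Sum>b\<in>Basis. G2 b x\<bar> \<le> C2" using C15(2) by blast
  obtain C3 where C3': "\<And>x. x \<in> ?S \<Longrightarrow> \<bar>\<Sum>b\<in>Basis. F1 b x * G1 b x\<bar> \<le> C3" using C15(3) by blast
  obtain C4 where C4': "\<And>x. x \<in> ?S \<Longrightarrow> \<bar>\<Sum>b\<in>Basis. (G1 b x)\<^sup>2\<bar> \<le> C4" using C15(4) by blast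
  obtain C5 where C5': "\<And>x. x \<in> ?S \<Longrightarrow> \<bar>G x\<bar> \<le> C5" using C15(5) by blast
  define C where "C = 1 + \<bar>B\<bar> + \<bar>C1\<bar> + \<bar>C2\<bar> + \<bar>C3\<bar> + \<bar>C4\<bar> + \<bar>C5\<bar>"
  have "C1 \<le> C" "C2 \<le> C" "C3 \<le> C" "C4 \<le> C" "C5 \<le> C" "B \<le> C" and C1: "1 \<le> C"
    unfolding C_def by linarith+
  note C = order_trans[OF C1' this(1)] order_trans[OF C2' this(2)] order_trans[OF C3' this(3)]
    order_trans[OF C4' this(4)] order_trans[OF C5' this(5)]
  have lipC: "\<bar>F x - F y\<bar> \<le> C * norm (x - y)" if "x \<in> ?S" "y \<in> ?S" for x y
    using lip[OF that] mult_right_mono[OF \<open>B \<le> C\<close>, of "norm (x - y)"] by simp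
  obtain x0 where x0: "x0 \<in> ?S" "\<And>x. x \<in> ?S \<Longrightarrow> G x0 \<le> G x"
    using continuous_attains_inf[OF compact_cball _ cont(2)] \<delta>0 by fastforce
  define c' where "c' = G x0"
  have c': "c' > 0" "\<And>x. x \<in> ?S \<Longrightarrow> c' \<le> G x" using x0 Gpos by (auto simp: c'_def)
  define c where "c = min c' 1"
  have c: "c > 0" "c \<le> 1" "\<And>x. x \<in> ?S \<Longrightarrow> c \<le> G x" using c' by (auto simp: c_def min.coboundedI1)
  define C' where "C' = 8 * C / c\<^sup>2"
  have C': "C' > 0" using C1 c by (simp add: C'_def)
  \<comment> \<open>Bounding \<open>q\<close> by \<open>\<theta> ^ 4\<close> yields the smallness
    \<open>C' * q powr (1/4) \<le> c / 8\<close> required in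
    \<open>barrier_bulk_negative\<close>.\<close>
  define \<theta> where "\<theta> = min 1 (c / (8 * C'))"
  have \<theta>: "0 < \<theta>" "\<theta> \<le> 1" "C' * \<theta> \<le> c / 8"
    using c C' by (auto simp: \<theta>_def min_def field_simps)
  \<comment> \<open>The first bound keeps the balls about \<open>p\<close> inside
    \<open>cball p0 \<delta>0\<close>. The second gives
    \<open>q \<le> (C * \<delta>)\<^sup>2 \<le> \<theta> ^ 4\<close>, since \<open>F p = 0\<close>
    and the Lipschitz bound make \<open>q\<close> at most \<open>C\<^sup>2\<close> times the squared
    distance to \<open>(p, 0)\<close>. Neither depends on \<open>p\<close>.\<close>
  define \<delta> where "\<delta> = min (\<delta>0 / 2) (\<theta>\<^sup>2 / C)"
  have \<delta>: "\<delta> > 0" "2 * \<delta> \<le> \<delta>0" "C * \<delta> \<le> \<theta>\<^sup>2"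
    using \<delta>0 \<theta> C1 by (auto simp: \<delta>_def min_def field_simps)
  \<comment> \<open>Chosen so that the margin \<open>K * c / 16\<close> exceeds the contribution
    \<open>(2 * DIM('a) + \<kappa>) / \<delta>\<^sup>2\<close> of the quadratic term by at least
    1.\<close>
  define K where "K = 16 / c * (\<bar>2 * DIM('a) + \<kappa>\<bar> / \<delta>\<^sup>2 + 1)"
  have K: "K > 0" using c by (simp add: K_def add_nonneg_pos)
  define K' where "K' = K * (C\<^sup>2) powr \<gamma> + (1 / \<delta>\<^sup>2) powr \<gamma>"
  have K': "K' > 0" using K C1 by (simp add: K'_def add_pos_nonneg)
  show ?thesis
  proof (rule exI[of _ \<delta>], rule conjI[OF \<delta>(1)], rule exI[of _ K'], rule conjI[OF K'], intro ballI impI conjI)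
    fix p assume p: "p \<in> cball p0 \<delta>" and Fp: "F p = 0"
    show sub: "cball p \<delta> \<subseteq> ?S"
    proof
      fix x assume "x \<in> cball p \<delta>"
      then have "dist p0 x \<le> \<delta> + \<delta>" using p dist_triangle[of p0 x p] by simp
      then show "x \<in> ?S" using \<delta> by simp
    qed
    define q where "q x w = (F x)\<^sup>2 + G x * w" for x w
    \<comment> \<open>As \<open>q \<le> 1\<close> on the half ball, the bracket is nonnegative, so
      \<open>h\<close> is at least its quadratic term, which equals 1 on the sphere of radius
      \<open>\<delta>\<close>.\<close>
    define h where "h x w = K * (q x w powr \<gamma> + (- 1) * q x w powr (\<gamma> + 1/4)) + 1 / \<delta>\<^sup>2 * ((norm (x - p))\<^sup>2 + w)" for x w
    have pS: "p \<in> ?S" using p \<delta>(1,2) by simp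
    have hbS: "x \<in> ?S" "w \<ge> 0" if "(x, w) \<in> half_ball p (\<delta>\<^sup>2)" for x w
    proof -
      show "w \<ge> 0" using that by (simp add: half_ball_def)
      have "(norm (x - p))\<^sup>2 \<le> \<delta>\<^sup>2" using that by (simp add: half_ball_def)
      then have "norm (x - p) \<le> \<delta>" using \<delta>(1) by (meson less_imp_le power2_le_imp_le)
      then show "x \<in> ?S" using sub by (auto simp: dist_norm norm_minus_commute)
    qed
    have qR: "0 \<le> q x w" "q x w \<le> C\<^sup>2 * ((norm (x - p))\<^sup>2 + w)" if "(x, w) \<in> half_ball p (\<delta>\<^sup>2)" for x w
    proof -
      note xw = hbS[OF that]
      show "0 \<le> q x w" using Gpos[OF xw(1)] xw(2) by (simp add: q_def)
      have "\<bar>F x\<bar> \<le> C * norm (x - p)" using lipC[OF xw(1) pS] Fp by simp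
      then have "\<bar>F x\<bar>\<^sup>2 \<le> (C * norm (x - p))\<^sup>2" by (intro power_mono) auto
      moreover have "G x \<le> C\<^sup>2"
      proof -
        have "G x \<le> C * 1" using C(5)[OF xw(1)] by simp
        also have "\<dots> \<le> C\<^sup>2" unfolding power2_eq_square by (rule mult_left_mono) (use C1 in auto)
        finally show ?thesis .
      qed
      then have "G x * w \<le> C\<^sup>2 * w" using xw(2) by (intro mult_right_mono)
      ultimately show "q x w \<le> C\<^sup>2 * ((norm (x - p))\<^sup>2 + w)"
        by (simp add: q_def power_mult_distrib distrib_left)
    qed
    have q\<theta>: "q x w \<le> \<theta> ^ 4" if "(x, w) \<in> half_ball p (\<delta>\<^sup>2)" for x w
    proof -
      have "q x w \<le> C\<^sup>2 * \<delta>\<^sup>2"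
        using qR(2)[OF that] that mult_left_mono[of "(norm (x - p))\<^sup>2 + w" "\<delta>\<^sup>2" "C\<^sup>2"]
        by (simp add: half_ball_def)
      also have "\<dots> = (C * \<delta>)\<^sup>2" by (simp add: power_mult_distrib)
      also have "\<dots> \<le> (\<theta>\<^sup>2)\<^sup>2" using \<delta> C1 by (intro power_mono) auto
      finally show ?thesis by simp
    qed
    have q1: "q x w \<le> 1" if "(x, w) \<in> half_ball p (\<delta>\<^sup>2)" for x w
      using q\<theta>[OF that] \<theta> power_le_one[of \<theta> 4] by linarith
    have mono: "q x w powr (\<gamma> + 1/4) \<le> q x w powr \<gamma>" if "(x, w) \<in> half_ball p (\<delta>\<^sup>2)" for x w
      using q1[OF that] qR(1)[OF that] by (cases "q x w = 0") (auto intro: powr_mono')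
    have "continuous_on (half_ball p (\<delta>\<^sup>2)) (\<lambda>X. F (fst X))"
      by (rule continuous_on_compose2[OF cont(1) continuous_on_fst[OF continuous_on_id]]) (use hbS in auto)
    moreover have "continuous_on (half_ball p (\<delta>\<^sup>2)) (\<lambda>X. G (fst X))"
      by (rule continuous_on_compose2[OF cont(2) continuous_on_fst[OF continuous_on_id]]) (use hbS in auto)
    ultimately have cq: "continuous_on (half_ball p (\<delta>\<^sup>2)) (\<lambda>X. q (fst X) (snd X))"
      unfolding q_def by (intro continuous_intros)
    have cqp: "continuous_on (half_ball p (\<delta>\<^sup>2)) (\<lambda>X. q (fst X) (snd X) powr r)" if "r > 0" for r
      by (rule continuous_on_powr'[OF cq continuous_on_const]) (use qR(1) that in auto)
    have L: "\<exists>v<0. has_L \<kappa> h x w v" if hb: "(x, w) \<in> half_ball p (\<delta>\<^sup>2)" and nz: "F x \<noteq> 0 \<or> 0 < w" for x w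
    proof -
      note xw = hbS[OF hb]
      have q0: "q x w > 0"
        using nz Gpos[OF xw(1)] xw(2) by (auto simp: q_def intro: add_pos_nonneg add_nonneg_pos)
      define e where "e r = 2 * F x * (\<Sum>b\<in>Basis. F2 b x) + w * (\<Sum>b\<in>Basis. G2 b x) +
       (r - 1) * (4 * w * F x * (\<Sum>b\<in>Basis. F1 b x * G1 b x) + w\<^sup>2 * (\<Sum>b\<in>Basis. (G1 b x)\<^sup>2)) / q x w" for r
      have hL: "has_L \<kappa> (\<lambda>x w. q x w powr r) x w (r * q x w powr (r - 1) * ((\<kappa> - 2 + 4 * r) * G x + e r))" for r
        unfolding q_def e_def
        by (rule has_L_defining_powr[OF F[OF xw(1)] G[OF xw(1)] grad[OF xw(1)] refl])
          (use q0 in \<open>auto simp: q_def\<close>)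
      have eb: "\<bar>e r\<bar> \<le> C' * sqrt (q x w)" if "0 \<le> r" "r \<le> 1" for r
        unfolding e_def C'_def
        by (rule defining_error_bound[OF q_def q0 q1[OF hb] c(1,2) c(3)[OF xw(1)] xw(2) C(1)[OF xw(1)]
              C(2)[OF xw(1)] C(3)[OF xw(1)] C(4)[OF xw(1)] that])
      have "q x w powr (1/4) \<le> (\<theta> ^ 4) powr (1/4)"
        using q\<theta>[OF hb] q0 by (intro powr_mono2) auto
      also have "\<dots> = \<theta>" using \<theta>(1) power_powr[of \<theta> 4 "1/4"] by simp
      finally have "C' * q x w powr (1/4) \<le> C' * \<theta>" by (rule mult_left_mono[OF _ less_imp_le[OF C']])
      then have small: "C' * q x w powr (1/4) \<le> c / 8" using \<theta>(3) by (rule order_trans)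
      have \<kappa>': "\<kappa> - 2 + 4 * \<gamma> = 0" "\<kappa> - 2 + 4 * (\<gamma> + 1/4) = 1" by (simp_all add: \<kappa>)
      have e1: "\<bar>e \<gamma>\<bar> \<le> C' * sqrt (q x w)" "\<bar>e (\<gamma> + 1/4)\<bar> \<le> C' * sqrt (q x w)"
        using \<gamma> by (intro eb; linarith)+
      let ?v1 = "\<gamma> * q x w powr (\<gamma> - 1) * ((\<kappa> - 2 + 4 * \<gamma>) * G x + e \<gamma>)"
      let ?v2 = "(\<gamma> + 1/4) * q x w powr (\<gamma> + 1/4 - 1) * ((\<kappa> - 2 + 4 * (\<gamma> + 1/4)) * G x + e (\<gamma> + 1/4))"
      have neg: "?v1 - ?v2 \<le> - c / 16"
        using barrier_bulk_negative[OF q0 q1[OF hb] small c(1) c(3)[OF xw(1)] less_imp_le[OF C'] e1 \<gamma>]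
        unfolding \<kappa>' mult_zero_left mult_1 add_0 .
      have "has_L \<kappa> h x w (K * (?v1 + (- 1) * ?v2) + 1 / \<delta>\<^sup>2 * (2 * DIM('a) + \<kappa>))"
        unfolding h_def
        by (rule has_L_add[OF has_L_cmult[OF has_L_add[OF hL has_L_cmult[OF hL]]] has_L_cmult[OF has_L_normsq]])
      moreover have "K * (?v1 + (- 1) * ?v2) + 1 / \<delta>\<^sup>2 * (2 * DIM('a) + \<kappa>) < 0"
      proof -
        have "K * (?v1 + (- 1) * ?v2) \<le> K * (- c / 16)"
          by (rule mult_left_mono) (use neg K in auto)
        also have "\<dots> = - (\<bar>2 * DIM('a) + \<kappa>\<bar> / \<delta>\<^sup>2) - 1" using c by (simp add: K_def field_simps)
        finally show ?thesis
          using divide_right_mono[OF abs_ge_self[of "2 * DIM('a) + \<kappa>"], of "\<delta>\<^sup>2"] by simp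
      qed
      ultimately show ?thesis by blast
    qed
    have hb: "0 \<le> h x w \<and> h x w \<le> K' * ((norm (x - p))\<^sup>2 + w) powr \<gamma> \<and>
        ((norm (x - p))\<^sup>2 + w = \<delta>\<^sup>2 \<longrightarrow> 1 \<le> h x w)" if hb: "(x, w) \<in> half_ball p (\<delta>\<^sup>2)" for x w
    proof -
      define R where "R = (norm (x - p))\<^sup>2 + w"
      have R: "0 \<le> R" "R \<le> \<delta>\<^sup>2" using hb by (auto simp: half_ball_def R_def)
      have hR: "h x w = K * (q x w powr \<gamma> - q x w powr (\<gamma> + 1/4)) + R / \<delta>\<^sup>2"
        by (simp add: h_def R_def)
      have n: "0 \<le> K * (q x w powr \<gamma> - q x w powr (\<gamma> + 1/4))" using mono[OF hb] K by simp
      \<comment> \<open>A number in [0, 1] is at most its power with exponent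
        \<open>\<gamma> \<le> 1\<close>. Thus the quadratic term, too, is bounded by a multiple of
        \<open>R powr \<gamma>\<close>.\<close>
      have "R / \<delta>\<^sup>2 \<le> (R / \<delta>\<^sup>2) powr \<gamma>"
      proof (cases "R = 0")
        case False
        have "(R / \<delta>\<^sup>2) powr 1 \<le> (R / \<delta>\<^sup>2) powr \<gamma>"
          using R \<delta> \<gamma> False by (intro powr_mono') auto
        then show ?thesis using R by simp
      qed simp
      also have "\<dots> = (1 / \<delta>\<^sup>2) powr \<gamma> * R powr \<gamma>"
        using R \<delta> powr_mult[of "1 / \<delta>\<^sup>2" R \<gamma>] by simp
      finally have 1: "R / \<delta>\<^sup>2 \<le> (1 / \<delta>\<^sup>2) powr \<gamma> * R powr \<gamma>" .
      have "q x w powr \<gamma> \<le> (C\<^sup>2 * R) powr \<gamma>"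
        using qR[OF hb] \<gamma> by (intro powr_mono2) (auto simp: R_def)
      also have "\<dots> = (C\<^sup>2) powr \<gamma> * R powr \<gamma>" using R by (intro powr_mult)
      finally have "K * (q x w powr \<gamma> - q x w powr (\<gamma> + 1/4)) \<le> K * ((C\<^sup>2) powr \<gamma> * R powr \<gamma>)"
        using K by (intro mult_left_mono) (auto intro: order_trans[of _ "q x w powr \<gamma>"])
      then have "h x w \<le> K' * R powr \<gamma>" using 1 unfolding hR K'_def by (simp add: algebra_simps)
      moreover have "0 \<le> h x w" using n R unfolding hR by simp
      moreover have "R = \<delta>\<^sup>2 \<longrightarrow> 1 \<le> h x w" using n \<delta> unfolding hR by auto
      ultimately show ?thesis unfolding R_def by blast
    qed
    show "\<exists>h. continuous_on (half_ball p (\<delta>\<^sup>2)) (\<lambda>X. h (fst X) (snd X)) \<and>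
     (\<forall>x w. (x, w) \<in> half_ball p (\<delta>\<^sup>2) \<and> (F x \<noteq> 0 \<or> 0 < w) \<longrightarrow> (\<exists>v<0. has_L \<kappa> h x w v)) \<and>
     (\<forall>x w. (x, w) \<in> half_ball p (\<delta>\<^sup>2) \<longrightarrow> 0 \<le> h x w \<and> h x w \<le> K' * ((norm (x - p))\<^sup>2 + w) powr \<gamma> \<and>
        ((norm (x - p))\<^sup>2 + w = \<delta>\<^sup>2 \<longrightarrow> 1 \<le> h x w))"
    proof (rule exI[of _ h], intro conjI)
      show "continuous_on (half_ball p (\<delta>\<^sup>2)) (\<lambda>X. h (fst X) (snd X))"
        unfolding h_def using \<gamma> by (intro continuous_intros cqp) auto
    qed (use L hb in blast)+
  qed
qed

section \<open>Defining functions of smooth hypersurfaces\<close>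

abbreviation dir_deriv :: "'a::euclidean_space \<Rightarrow> ('a \<Rightarrow> 'b::euclidean_space) \<Rightarrow> 'a \<Rightarrow> 'b" where
  "dir_deriv b f \<equiv> \<lambda>x. frechet_derivative f (at x) b"

lemma Ck_on_continuous_on: "Ck_on k S f \<Longrightarrow> continuous_on S f"
proof (cases k)
  case (Suc n)
  assume "Ck_on k S f"
  then have "f differentiable_on S"
    unfolding differentiable_on_def Suc using differentiable_at_withinI by auto
  then show ?thesis by (rule differentiable_imp_continuous_on)
qed simp

lemma Ck_on_SucD:
  assumes "Ck_on (Suc k) S f" "x \<in> S"
  shows "(f has_derivative frechet_derivative f (at x)) (at x)"
  using assms by (auto simp: frechet_derivative_works[symmetric])

lemma Ck_on_line_derivative:
  assumes "Ck_on (Suc k) S f" "x + t *\<^sub>R b \<in> S"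
  shows "((\<lambda>t. f (x + t *\<^sub>R b) \<bullet> n) has_real_derivative dir_deriv b f (x + t *\<^sub>R b) \<bullet> n) (at t)"
proof -
  have f: "(f has_derivative frechet_derivative f (at (x + t *\<^sub>R b))) (at (x + t *\<^sub>R b))"
    by (rule Ck_on_SucD[OF assms])
  interpret bounded_linear "frechet_derivative f (at (x + t *\<^sub>R b))"
    using f by (rule has_derivative_bounded_linear)
  have "((\<lambda>t. x + t *\<^sub>R b) has_derivative (\<lambda>h. h *\<^sub>R b)) (at t)"
    by (auto intro!: derivative_eq_intros)
  from has_derivative_compose[OF this f]
  have "((\<lambda>t. f (x + t *\<^sub>R b) \<bullet> n) has_derivative (\<lambda>h. frechet_derivative f (at (x + t *\<^sub>R b)) (h *\<^sub>R b) \<bullet> n)) (at t)"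
    by (rule has_derivative_inner_left)
  then show ?thesis by (simp add: has_field_derivative_def scaleR mult_commute_abs)
qed

lemma Ck_on_jet2:
  assumes "open S" "Ck_on (Suc (Suc k)) S f" "x \<in> S"
  shows "jet2 (\<lambda>t. f (x + t *\<^sub>R b) \<bullet> n) 0 (dir_deriv b f x \<bullet> n) (dir_deriv b (dir_deriv b f) x \<bullet> n)"
proof (rule jet2I[where f' = "\<lambda>t. dir_deriv b f (x + t *\<^sub>R b) \<bullet> n"])
  have "((\<lambda>t. x + t *\<^sub>R b) \<longlongrightarrow> x + 0 *\<^sub>R b) (nhds 0)"
    by (intro tendsto_intros filterlim_ident)
  then have "\<forall>\<^sub>F t in nhds 0. x + t *\<^sub>R b \<in> S"
    using assms by (intro topological_tendstoD) auto
  then show "\<forall>\<^sub>F t in nhds 0. ((\<lambda>t. f (x + t *\<^sub>R b) \<bullet> n) has_real_derivative dir_deriv b f (x + t *\<^sub>R b) \<bullet> n) (at t)"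
    by eventually_elim (rule Ck_on_line_derivative[OF assms(2)])
  have "Ck_on (Suc k) S (dir_deriv b f)" using assms(2) by simp
  from Ck_on_line_derivative[OF this, of x 0 b n] assms(3)
  show "((\<lambda>t. dir_deriv b f (x + t *\<^sub>R b) \<bullet> n) has_real_derivative dir_deriv b (dir_deriv b f) x \<bullet> n) (at 0)" by simp
qed simp

lemma linear_eq_sum_Basis:
  assumes "linear f"
  shows "f h = (\<Sum>b\<in>Basis. (h \<bullet> b) *\<^sub>R f b)"
proof -
  have "f h = f (\<Sum>b\<in>Basis. (h \<bullet> b) *\<^sub>R b)" by (simp add: euclidean_representation)
  also have "\<dots> = (\<Sum>b\<in>Basis. (h \<bullet> b) *\<^sub>R f b)"
    using assms by (simp add: linear_sum linear_scale)
  finally show ?thesis .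
qed

text \<open>In codimension one the subspace of a slice chart is a hyperplane with some normal
  \<open>n\<close>, so the component of the chart along \<open>n\<close> defines \<open>A\<close>.
  Its differential vanishes nowhere: differentiating \<open>\<phi> (\<psi> y) = y\<close> shows that
  the differential of \<open>\<phi>\<close> attains \<open>n\<close> itself.\<close>

lemma smooth_submanifold_defining_map:
  fixes A :: "'a::euclidean_space set"
  assumes "smooth_submanifold l A" "DIM('a) = l + 1" "p0 \<in> A"
  obtains U and \<phi> :: "'a \<Rightarrow> 'a" and n where "open U" "p0 \<in> U" "\<And>k. Ck_on k U \<phi>"
    "\<And>x. x \<in> U \<Longrightarrow> x \<in> A \<longleftrightarrow> \<phi> x \<bullet> n = 0" "\<And>x. x \<in> U \<Longrightarrow> \<exists>b\<in>Basis. dir_deriv b \<phi> x \<bullet> n \<noteq> 0"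
proof -
  obtain U V \<phi> \<psi> L where UV: "open U" "p0 \<in> U" "open (V :: 'a set)"
      "C_infinity_diffeomorphism U V \<phi> \<psi>" "subspace L" "dim L = l" "\<phi> ` (U \<inter> A) = V \<inter> L"
    using assms(1,3) unfolding smooth_submanifold_def by meson
  have hom: "homeomorphism U V \<phi> \<psi>" and Ck: "\<And>k. Ck_on k U \<phi>" "\<And>k. Ck_on k V \<psi>"
    using UV(4) by (auto simp: C_infinity_diffeomorphism_def C_infinity_on_def)
  obtain n where n: "n \<noteq> 0" "span L = {x. n \<bullet> x = 0}"
    using lowdim_eq_hyperplane[of L] UV(6) assms(2) by auto
  have "span L = L" using UV(5) by (simp add: span_eq_iff)
  then have L: "x \<in> L \<longleftrightarrow> x \<bullet> n = 0" for x
    using n(2) by (auto simp: inner_commute)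
  have inj: "\<psi> (\<phi> x) = x" "\<phi> x \<in> V" if "x \<in> U" for x
    using homeomorphism_apply1[OF hom that] homeomorphism_image1[OF hom] that by auto
  show ?thesis
  proof
    show "open U" "p0 \<in> U" "\<And>k. Ck_on k U \<phi>" by fact+
    show "x \<in> A \<longleftrightarrow> \<phi> x \<bullet> n = 0" if "x \<in> U" for x
    proof
      assume "x \<in> A" then have "\<phi> x \<in> V \<inter> L" using UV(7) that by blast
      then show "\<phi> x \<bullet> n = 0" using L by simp
    next
      assume "\<phi> x \<bullet> n = 0"
      then have "\<phi> x \<in> \<phi> ` (U \<inter> A)" using UV(7) L inj(2)[OF that] by simp
      then show "x \<in> A" using inj(1) that by (metis Int_iff imageE)
    qed
    show "\<exists>b\<in>Basis. dir_deriv b \<phi> x \<bullet> n \<noteq> 0" if x: "x \<in> U" for x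
    proof (rule ccontr)
      assume "\<not> ?thesis"
      then have 0: "\<And>b. b \<in> Basis \<Longrightarrow> dir_deriv b \<phi> x \<bullet> n = 0" by blast
      have d\<phi>: "(\<phi> has_derivative frechet_derivative \<phi> (at x)) (at x)"
        using Ck_on_SucD[OF Ck(1) x] .
      have d\<psi>: "(\<psi> has_derivative frechet_derivative \<psi> (at (\<phi> x))) (at (\<phi> x))"
        using Ck_on_SucD[OF Ck(2) inj(2)[OF x]] .
      have "((\<lambda>y. \<phi> (\<psi> y)) has_derivative (\<lambda>h. frechet_derivative \<phi> (at x) (frechet_derivative \<psi> (at (\<phi> x)) h))) (at (\<phi> x))"
        using has_derivative_compose[OF d\<psi>, of \<phi> "frechet_derivative \<phi> (at x)"] d\<phi> inj(1)[OF x] by simp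
      then have "((\<lambda>y. y) has_derivative (\<lambda>h. frechet_derivative \<phi> (at x) (frechet_derivative \<psi> (at (\<phi> x)) h))) (at (\<phi> x))"
        by (rule has_derivative_transform_within_open[OF _ UV(3) inj(2)[OF x]])
          (rule homeomorphism_apply2[OF hom])
      then have "(\<lambda>h. frechet_derivative \<phi> (at x) (frechet_derivative \<psi> (at (\<phi> x)) h)) = (\<lambda>h. h)"
        using has_derivative_ident has_derivative_unique by blast
      then have "frechet_derivative \<phi> (at x) (frechet_derivative \<psi> (at (\<phi> x)) n) = n" by metis
      moreover have "frechet_derivative \<phi> (at x) h \<bullet> n = 0" for h
        using 0 linear_eq_sum_Basis[OF has_derivative_linear[OF d\<phi>], of h]
        by (simp add: inner_sum_left)
      ultimately show False using n(1) by (metis inner_eq_zero_iff)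
    qed
  qed
qed

text \<open>A chart carries \<open>A\<close> near \<open>p0\<close> onto a set containing a segment
  of a subspace of positive dimension. This guarantees points of \<open>A\<close> off any finite set
  of poles.\<close>

lemma smooth_submanifold_infinite:
  fixes A :: "'a::euclidean_space set"
  assumes "smooth_submanifold l A" "l \<ge> 1" "p0 \<in> A"
  shows "infinite A"
proof
  assume fin: "finite A"
  obtain U V \<phi> \<psi> L where UV: "open U" "p0 \<in> U" "open (V :: 'a set)"
      "C_infinity_diffeomorphism U V \<phi> \<psi>" "subspace L" "dim L = l" "\<phi> ` (U \<inter> A) = V \<inter> L"
    using assms(1,3) unfolding smooth_submanifold_def by meson
  have y: "\<phi> p0 \<in> V" "\<phi> p0 \<in> L" using UV assms(3) by blast+
  have "\<not> L \<subseteq> {0}" using UV(6) assms(2) dim_eq_0[of L] by auto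
  then obtain v where v: "v \<in> L" "v \<noteq> 0" by blast
  have "((\<lambda>t. \<phi> p0 + t *\<^sub>R v) \<longlongrightarrow> \<phi> p0 + 0 *\<^sub>R v) (nhds 0)"
    by (intro tendsto_intros filterlim_ident)
  then have "\<forall>\<^sub>F t in nhds 0. \<phi> p0 + t *\<^sub>R v \<in> V"
    using UV(3) y(1) by (intro topological_tendstoD) auto
  then obtain e where e: "e > 0" "\<And>t. dist t 0 < e \<Longrightarrow> \<phi> p0 + t *\<^sub>R v \<in> V"
    unfolding eventually_nhds_metric by blast
  have "(\<lambda>t. \<phi> p0 + t *\<^sub>R v) ` {0<..<e} \<subseteq> V \<inter> L"
    using e(2) y(2) v(1) UV(5) by (auto simp: subspace_add subspace_scale)
  moreover have "finite (V \<inter> L)" using UV(7) fin by (metis finite_Int finite_imageI)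
  ultimately have "finite ((\<lambda>t. \<phi> p0 + t *\<^sub>R v) ` {0<..<e})" by (rule finite_subset)
  then have "finite {0<..<e}"
    by (rule finite_imageD) (use v(2) in \<open>auto simp: inj_on_def\<close>)
  then show False using infinite_Ioo[OF e(1)] by blast
qed

lemma local_defining_function:
  fixes A :: "'a::euclidean_space set"
  assumes "smooth_submanifold l A" "DIM('a) = l + 1" "p0 \<in> A"
  obtains \<delta> :: real and F :: "'a \<Rightarrow> real" and F1 F2 :: "'a \<Rightarrow> 'a \<Rightarrow> real"
    and G :: "'a \<Rightarrow> real" and G1 G2 :: "'a \<Rightarrow> 'a \<Rightarrow> real" and B :: real where
    "\<delta> > 0" "\<And>x. x \<in> cball p0 \<delta> \<Longrightarrow> x \<in> A \<longleftrightarrow> F x = 0"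
    "\<And>x b. x \<in> cball p0 \<delta> \<Longrightarrow> b \<in> Basis \<Longrightarrow> jet2 (\<lambda>t. F (x + t *\<^sub>R b)) 0 (F1 b x) (F2 b x)"
    "\<And>x b. x \<in> cball p0 \<delta> \<Longrightarrow> b \<in> Basis \<Longrightarrow> jet2 (\<lambda>t. G (x + t *\<^sub>R b)) 0 (G1 b x) (G2 b x)"
    "continuous_on (cball p0 \<delta>) F" "continuous_on (cball p0 \<delta>) G"
    "\<And>b. b \<in> Basis \<Longrightarrow> continuous_on (cball p0 \<delta>) (F1 b)"
    "\<And>b. b \<in> Basis \<Longrightarrow> continuous_on (cball p0 \<delta>) (F2 b)"
    "\<And>b. b \<in> Basis \<Longrightarrow> continuous_on (cball p0 \<delta>) (G1 b)"
    "\<And>b. b \<in> Basis \<Longrightarrow> continuous_on (cball p0 \<delta>) (G2 b)"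
    "\<And>x. x \<in> cball p0 \<delta> \<Longrightarrow> G x = (\<Sum>b\<in>Basis. (F1 b x)\<^sup>2)"
    "\<And>x. x \<in> cball p0 \<delta> \<Longrightarrow> G x > 0"
    "\<And>x y. x \<in> cball p0 \<delta> \<Longrightarrow> y \<in> cball p0 \<delta> \<Longrightarrow> \<bar>F x - F y\<bar> \<le> B * norm (x - y)"
proof -
  obtain U and \<phi> :: "'a \<Rightarrow> 'a" and n where U: "open U" "p0 \<in> U" "\<And>k. Ck_on k U \<phi>"
    "\<And>x. x \<in> U \<Longrightarrow> x \<in> A \<longleftrightarrow> \<phi> x \<bullet> n = 0" "\<And>x. x \<in> U \<Longrightarrow> \<exists>b\<in>Basis. dir_deriv b \<phi> x \<bullet> n \<noteq> 0"
    using smooth_submanifold_defining_map[OF assms] by metis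
  obtain \<delta> where \<delta>: "\<delta> > 0" "cball p0 \<delta> \<subseteq> U"
    using U(1,2) open_contains_cball by blast
  let ?S = "cball p0 \<delta>"
  have Ck1: "Ck_on k U (dir_deriv b \<phi>)" for k b using U(3)[of "Suc k"] by simp
  have Ck2: "Ck_on k U (dir_deriv c (dir_deriv b \<phi>))" for k b c using Ck1[of "Suc k"] by simp
  have Ck3: "Ck_on k U (dir_deriv d (dir_deriv c (dir_deriv b \<phi>)))" for k b c d using Ck2[of "Suc k"] by simp
  have cont: "continuous_on ?S f" if "\<And>k. Ck_on k U f" for f :: "'a \<Rightarrow> 'a"
    using Ck_on_continuous_on[OF that] \<delta>(2) continuous_on_subset by blast
  note cS = cont[OF U(3)] cont[OF Ck1] cont[OF Ck2] cont[OF Ck3]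
  define F where "F x = \<phi> x \<bullet> n" for x
  define F1 where "F1 b x = dir_deriv b \<phi> x \<bullet> n" for b x
  define F2 where "F2 b x = dir_deriv b (dir_deriv b \<phi>) x \<bullet> n" for b x
  \<comment> \<open>Squares are written as products so that \<open>jet2_mult\<close> and
    \<open>jet2_sum\<close> return exactly \<open>G1\<close> and \<open>G2\<close>.\<close>
  define G where "G x = (\<Sum>c\<in>Basis. F1 c x * F1 c x)" for x
  define G1 where "G1 b x = (\<Sum>c\<in>Basis. (dir_deriv b (dir_deriv c \<phi>) x \<bullet> n) * F1 c x + F1 c x * (dir_deriv b (dir_deriv c \<phi>) x \<bullet> n))" for b x
  define G2 where "G2 b x = (\<Sum>c\<in>Basis. (dir_deriv b (dir_deriv b (dir_deriv c \<phi>)) x \<bullet> n) * F1 c x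
      + 2 * (dir_deriv b (dir_deriv c \<phi>) x \<bullet> n) * (dir_deriv b (dir_deriv c \<phi>) x \<bullet> n) + F1 c x * (dir_deriv b (dir_deriv b (dir_deriv c \<phi>)) x \<bullet> n))" for b x
  \<comment> \<open>The sum of the absolute partial derivatives dominates the operator norm of the
    differential of \<open>F\<close>; a bound for it on the convex ball is a Lipschitz
    constant.\<close>
  have "continuous_on ?S (\<lambda>x. \<Sum>b\<in>Basis. \<bar>F1 b x\<bar>)"
    unfolding F1_def by (intro continuous_intros cS)
  then have "bounded ((\<lambda>x. \<Sum>b\<in>Basis. \<bar>F1 b x\<bar>) ` ?S)"
    by (intro compact_imp_bounded compact_continuous_image compact_cball)
  then obtain B where B: "\<And>x. x \<in> ?S \<Longrightarrow> (\<Sum>b\<in>Basis. \<bar>F1 b x\<bar>) \<le> B"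
    by (fastforce simp: bounded_iff)
  show ?thesis
  proof
    show "\<delta> > 0" by fact
    show "x \<in> A \<longleftrightarrow> F x = 0" if "x \<in> ?S" for x using U(4) \<delta>(2) that by (auto simp: F_def)
    show "jet2 (\<lambda>t. F (x + t *\<^sub>R b)) 0 (F1 b x) (F2 b x)" if "x \<in> ?S" for x b
      unfolding F_def F1_def F2_def using Ck_on_jet2[OF U(1) U(3)] \<delta>(2) that by blast
    show "jet2 (\<lambda>t. G (x + t *\<^sub>R b)) 0 (G1 b x) (G2 b x)" if "x \<in> ?S" for x b
    proof -
      have "jet2 (\<lambda>t. F1 c (x + t *\<^sub>R b)) 0 (dir_deriv b (dir_deriv c \<phi>) x \<bullet> n) (dir_deriv b (dir_deriv b (dir_deriv c \<phi>)) x \<bullet> n)" for c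
        unfolding F1_def using Ck_on_jet2[OF U(1) Ck1] \<delta>(2) that by blast
      from jet2_mult[OF this this]
      have "jet2 (\<lambda>t. F1 c (x + t *\<^sub>R b) * F1 c (x + t *\<^sub>R b)) 0
          ((dir_deriv b (dir_deriv c \<phi>) x \<bullet> n) * F1 c x + F1 c x * (dir_deriv b (dir_deriv c \<phi>) x \<bullet> n))
          ((dir_deriv b (dir_deriv b (dir_deriv c \<phi>)) x \<bullet> n) * F1 c x + 2 * (dir_deriv b (dir_deriv c \<phi>) x \<bullet> n) * (dir_deriv b (dir_deriv c \<phi>) x \<bullet> n)
            + F1 c x * (dir_deriv b (dir_deriv b (dir_deriv c \<phi>)) x \<bullet> n))" for c
        by (simp only: scaleR_zero_left add_0_right)
      then show ?thesis unfolding G_def G1_def G2_def by (rule jet2_sum)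
    qed
    show "continuous_on ?S F" "continuous_on ?S G" "continuous_on ?S (F1 b)" "continuous_on ?S (F2 b)"
      "continuous_on ?S (G1 b)" "continuous_on ?S (G2 b)" for b
      unfolding F_def G_def F1_def F2_def G1_def G2_def by (intro continuous_intros cS)+
    show G: "G x = (\<Sum>b\<in>Basis. (F1 b x)\<^sup>2)" for x by (simp add: G_def power2_eq_square)
    show "G x > 0" if x: "x \<in> ?S" for x
    proof -
      have "x \<in> U" using \<delta>(2) x by blast
      then obtain b where "b \<in> Basis" "F1 b x \<noteq> 0" unfolding F1_def using U(5) by blast
      then show ?thesis unfolding G by (intro sum_pos2[of _ b]) auto
    qed
    show "\<bar>F x - F y\<bar> \<le> B * norm (x - y)" if "x \<in> ?S" "y \<in> ?S" for x y
    proof -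
      have d: "(\<phi> has_derivative frechet_derivative \<phi> (at x)) (at x)" if "x \<in> ?S" for x
        using Ck_on_SucD[OF U(3)] \<delta>(2) that by blast
      have "norm (F x - F y) \<le> B * norm (x - y)"
      proof (rule differentiable_bound[OF convex_cball _ _ that])
        fix x assume x: "x \<in> ?S"
        show "(F has_derivative (\<lambda>h. frechet_derivative \<phi> (at x) h \<bullet> n)) (at x within ?S)"
          unfolding F_def using has_derivative_at_withinI[OF has_derivative_inner_left[OF d[OF x]]] .
        show "onorm (\<lambda>h. frechet_derivative \<phi> (at x) h \<bullet> n) \<le> B"
        proof (rule onorm_le)
          fix h
          have "frechet_derivative \<phi> (at x) h \<bullet> n = (\<Sum>b\<in>Basis. (h \<bullet> b) * F1 b x)"
            using linear_eq_sum_Basis[OF has_derivative_linear[OF d[OF x]], of h]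
            by (simp add: inner_sum_left F1_def)
          also have "norm \<dots> \<le> (\<Sum>b\<in>Basis. norm h * \<bar>F1 b x\<bar>)"
            by (intro sum_norm_le) (auto simp: abs_mult Basis_le_norm intro!: mult_right_mono)
          also have "\<dots> = (\<Sum>b\<in>Basis. \<bar>F1 b x\<bar>) * norm h" by (simp add: sum_distrib_left mult.commute)
          also have "\<dots> \<le> B * norm h" using B[OF x] by (intro mult_right_mono) auto
          finally show "norm (frechet_derivative \<phi> (at x) h \<bullet> n) \<le> B * norm h" .
        qed
      qed
      then show ?thesis by simp
    qed
  qed
qed

section \<open>Greedy points\<close>

text \<open>The minimum principle with \<open>E = A\<close> compares the potential with
  \<open>m * (1 - h)\<close>, where \<open>h\<close> is the barrier at \<open>p\<close>. Over
  \<open>A\<close> the bound \<open>m\<close> suffices as \<open>h \<ge> 0\<close>; on the sphere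
  \<open>h \<ge> 1\<close> makes the comparison function nonpositive. The growth bound on
  \<open>h\<close> then gives the rate.\<close>

lemma local_potential_lower_bound:
  fixes A :: "'a::euclidean_space set" and s :: real
  assumes A: "smooth_submanifold l A" "DIM('a) = l + 1" "p0 \<in> A"
    and s: "s > 0" "real l - 1 \<le> s" "s < real l"
  shows "\<exists>\<delta>>0. \<exists>K>0. \<forall>p\<in>A \<inter> cball p0 \<delta>. \<forall>(J :: nat set) a m x w.
     finite J \<and> 0 < m \<and> (\<forall>y\<in>A - a ` J. m \<le> riesz_potential J a s y 0) \<and> (x, w) \<in> half_ball p (\<delta>\<^sup>2) \<and> (x \<notin> a ` J \<or> 0 < w) \<longrightarrow>
     m * (1 - K * ((norm (x - p))\<^sup>2 + w) powr ((real l - s) / 2)) \<le> riesz_potential J a s x w"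
proof -
  define \<gamma> where "\<gamma> = (real l - s) / 2"
  \<comment> \<open>With \<open>DIM('a) = l + 1\<close> this is the same \<open>\<kappa>\<close> as
    in \<open>has_L_kernel\<close>, so barrier and kernel belong to one operator. Its nonnegativity
    is exactly \<open>s \<ge> l - 1\<close>.\<close>
  define \<kappa> where "\<kappa> = 2 - 4 * \<gamma>"
  have \<gamma>: "0 < \<gamma>" "\<gamma> \<le> 1 / 2" using s by (auto simp: \<gamma>_def)
  have \<kappa>: "\<kappa> = 2 * (s + 2 - DIM('a))" "\<kappa> \<ge> 0" using \<gamma> by (auto simp: \<kappa>_def \<gamma>_def A(2) field_simps)
  obtain \<delta>0 :: real and F :: "'a \<Rightarrow> real" and F1 F2 :: "'a \<Rightarrow> 'a \<Rightarrow> real"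
    and G :: "'a \<Rightarrow> real" and G1 G2 :: "'a \<Rightarrow> 'a \<Rightarrow> real" and B :: real where D:
    "\<delta>0 > 0" "\<And>x. x \<in> cball p0 \<delta>0 \<Longrightarrow> x \<in> A \<longleftrightarrow> F x = 0"
    "\<And>x b. x \<in> cball p0 \<delta>0 \<Longrightarrow> b \<in> Basis \<Longrightarrow> jet2 (\<lambda>t. F (x + t *\<^sub>R b)) 0 (F1 b x) (F2 b x)"
    "\<And>x b. x \<in> cball p0 \<delta>0 \<Longrightarrow> b \<in> Basis \<Longrightarrow> jet2 (\<lambda>t. G (x + t *\<^sub>R b)) 0 (G1 b x) (G2 b x)"
    "continuous_on (cball p0 \<delta>0) F" "continuous_on (cball p0 \<delta>0) G"
    "\<And>b. b \<in> Basis \<Longrightarrow> continuous_on (cball p0 \<delta>0) (F1 b)"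
    "\<And>b. b \<in> Basis \<Longrightarrow> continuous_on (cball p0 \<delta>0) (F2 b)"
    "\<And>b. b \<in> Basis \<Longrightarrow> continuous_on (cball p0 \<delta>0) (G1 b)"
    "\<And>b. b \<in> Basis \<Longrightarrow> continuous_on (cball p0 \<delta>0) (G2 b)"
    "\<And>x. x \<in> cball p0 \<delta>0 \<Longrightarrow> G x = (\<Sum>b\<in>Basis. (F1 b x)\<^sup>2)"
    "\<And>x. x \<in> cball p0 \<delta>0 \<Longrightarrow> G x > 0"
    "\<And>x y. x \<in> cball p0 \<delta>0 \<Longrightarrow> y \<in> cball p0 \<delta>0 \<Longrightarrow> \<bar>F x - F y\<bar> \<le> B * norm (x - y)"
    by (fact local_defining_function[OF A])
  obtain \<delta> K where \<delta>: "\<delta> > 0" and K: "K > 0" and bar: "\<forall>p\<in>cball p0 \<delta>. F p = 0 \<longrightarrow>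
     cball p \<delta> \<subseteq> cball p0 \<delta>0 \<and> (\<exists>h.
     continuous_on (half_ball p (\<delta>\<^sup>2)) (\<lambda>X. h (fst X) (snd X)) \<and>
     (\<forall>x w. (x, w) \<in> half_ball p (\<delta>\<^sup>2) \<and> (F x \<noteq> 0 \<or> 0 < w) \<longrightarrow> (\<exists>v<0. has_L \<kappa> h x w v)) \<and>
     (\<forall>x w. (x, w) \<in> half_ball p (\<delta>\<^sup>2) \<longrightarrow> 0 \<le> h x w \<and> h x w \<le> K * ((norm (x - p))\<^sup>2 + w) powr \<gamma> \<and>
        ((norm (x - p))\<^sup>2 + w = \<delta>\<^sup>2 \<longrightarrow> 1 \<le> h x w)))"
    by (rule exE[OF barrier_exists[OF D(1) D(3-13) \<gamma> \<kappa>_def]], assumption+, elim conjE exE, rule that, assumption+)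
  \<comment> \<open>The barrier still lives on the half ball of radius \<open>\<delta>\<close>. The
    smaller radius also puts \<open>p\<close> into \<open>cball p0 \<delta>0\<close>, where
    \<open>F\<close> describes \<open>A\<close>.\<close>
  define d where "d = min \<delta> \<delta>0"
  have main: "m * (1 - K * ((norm (x - p))\<^sup>2 + w) powr \<gamma>) \<le> riesz_potential J a s x w"
    if p: "p \<in> A" "p \<in> cball p0 d" and J: "finite J" and m: "0 < m" "\<And>y. y \<in> A \<Longrightarrow> y \<notin> a ` J \<Longrightarrow> m \<le> riesz_potential J a s y 0"
      and xw: "(x, w) \<in> half_ball p (d\<^sup>2)" "x \<notin> a ` J \<or> 0 < w"
    for p m x w and J :: "nat set" and a
  proof -
    have p': "p \<in> cball p0 \<delta>" "p \<in> cball p0 \<delta>0" using p by (auto simp: d_def)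
    then have "F p = 0" using D(2) p(1) by blast
    from mp[OF bspec[OF bar p'(1)] this] obtain h where sub: "cball p \<delta> \<subseteq> cball p0 \<delta>0" and
      h: "continuous_on (half_ball p (\<delta>\<^sup>2)) (\<lambda>X. h (fst X) (snd X))"
      "\<And>x w. (x, w) \<in> half_ball p (\<delta>\<^sup>2) \<Longrightarrow> F x \<noteq> 0 \<or> 0 < w \<Longrightarrow> \<exists>v<0. has_L \<kappa> h x w v"
      "\<And>x w. (x, w) \<in> half_ball p (\<delta>\<^sup>2) \<Longrightarrow> 0 \<le> h x w"
      "\<And>x w. (x, w) \<in> half_ball p (\<delta>\<^sup>2) \<Longrightarrow> h x w \<le> K * ((norm (x - p))\<^sup>2 + w) powr \<gamma>"
      "\<And>x w. (x, w) \<in> half_ball p (\<delta>\<^sup>2) \<Longrightarrow> (norm (x - p))\<^sup>2 + w = \<delta>\<^sup>2 \<Longrightarrow> 1 \<le> h x w"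
      by blast
    have "d\<^sup>2 \<le> \<delta>\<^sup>2" using \<delta> D(1) by (intro power_mono) (auto simp: d_def)
    then have xw': "(x, w) \<in> half_ball p (\<delta>\<^sup>2)" using xw(1) by (auto simp: half_ball_def)
    have AF: "F y \<noteq> 0" if "y \<notin> A" "(y, v) \<in> half_ball p (\<delta>\<^sup>2)" for y v
    proof -
      have "(norm (y - p))\<^sup>2 \<le> \<delta>\<^sup>2" using that by (simp add: half_ball_def)
      then have "norm (y - p) \<le> \<delta>" using \<delta> by (meson less_imp_le power2_le_imp_le)
      then have "y \<in> cball p0 \<delta>0" using sub by (auto simp: dist_norm norm_minus_commute)
      then show ?thesis using D(2) that(1) by blast
    qed
    have pot0: "riesz_potential J a s y v \<ge> 0" for y v by (auto simp: riesz_potential_def intro: sum_nonneg)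
    have "m + (- m) * h x w \<le> riesz_potential J a s x w"
    proof (rule min_principle[OF J s(1) \<kappa>])
      show "continuous_on (half_ball p (\<delta>\<^sup>2)) (\<lambda>X. m + (- m) * h (fst X) (snd X))"
        by (intro continuous_intros h(1))
      show "\<exists>v>0. has_L \<kappa> (\<lambda>x w. m + (- m) * h x w) y v' v"
        if yv: "0 \<le> v'" "(norm (y - p))\<^sup>2 + v' < \<delta>\<^sup>2" "y \<notin> A \<or> 0 < v'" for y v'
      proof -
        have hb: "(y, v') \<in> half_ball p (\<delta>\<^sup>2)" using yv by (simp add: half_ball_def)
        then obtain v where v: "v < 0" "has_L \<kappa> h y v' v" using h(2) AF yv(3) by blast
        have "has_L \<kappa> (\<lambda>x w. m + (- m) * h x w) y v' (0 + (- m) * v)"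
          by (rule has_L_add[OF has_L_const has_L_cmult[OF v(2)]])
        moreover have "0 + (- m) * v > 0" using v(1) m(1) by (simp add: mult_pos_neg)
        ultimately show ?thesis by blast
      qed
      show "m + (- m) * h y v \<le> riesz_potential J a s y v"
        if "0 \<le> v" "(norm (y - p))\<^sup>2 + v \<le> \<delta>\<^sup>2" "(norm (y - p))\<^sup>2 + v = \<delta>\<^sup>2 \<or> y \<in> A \<and> v = 0" "y \<notin> a ` J \<or> 0 < v" for y v
      proof -
        have hb: "(y, v) \<in> half_ball p (\<delta>\<^sup>2)" using that by (simp add: half_ball_def)
        show ?thesis using that(3)
        proof
          assume "(norm (y - p))\<^sup>2 + v = \<delta>\<^sup>2"
          then have "m * 1 \<le> m * h y v" using h(5)[OF hb] m(1) by (intro mult_left_mono) auto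
          then show ?thesis using pot0[of y v] by simp
        next
          assume yA: "y \<in> A \<and> v = 0"
          then have "m \<le> riesz_potential J a s y v" using m(2) that(4) by auto
          moreover have "m * h y v \<ge> 0" using h(3)[OF hb] m(1) by simp
          ultimately show ?thesis by simp
        qed
      qed
    qed (use xw' xw(2) in \<open>auto simp: half_ball_def\<close>)
    moreover have "m * h x w \<le> m * (K * ((norm (x - p))\<^sup>2 + w) powr \<gamma>)"
      using h(4)[OF xw'] m(1) by (intro mult_left_mono) auto
    ultimately show ?thesis by (simp add: algebra_simps)
  qed
  have d: "d > 0" using \<delta> D(1) by (simp add: d_def)
  show ?thesis unfolding \<gamma>_def[symmetric]
  proof (rule exI[of _ d], rule conjI[OF d], rule exI[of _ K], rule conjI[OF K],
      intro ballI allI impI, elim conjE IntE)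
    fix p and J :: "nat set" and a m x w
    assume h: "p \<in> A" "p \<in> cball p0 d" "finite J" "0 < m" "\<forall>y\<in>A - a ` J. m \<le> riesz_potential J a s y 0"
      "(x, w) \<in> half_ball p (d\<^sup>2)" "x \<notin> a ` J \<or> 0 < w"
    show "m * (1 - K * ((norm (x - p))\<^sup>2 + w) powr \<gamma>) \<le> riesz_potential J a s x w"
      by (rule main[OF h(1-4) _ h(6,7)]) (use h(5) in blast)
  qed
qed

text \<open>A finite subcover allows the least radius and the largest constant to be taken, and
  \<open>mono\<close> transfers the local estimates to them. The 1 inserted in both sets covers an
  empty subcover.\<close>

lemma compact_locally_uniform:
  fixes A :: "'a::metric_space set"
  assumes "compact A"
    and loc: "\<And>p0. p0 \<in> A \<Longrightarrow> \<exists>\<delta>>0. \<exists>K>0. \<forall>p\<in>A \<inter> cball p0 \<delta>. P \<delta> K p"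
    and mono: "\<And>\<delta> \<delta>' K K' p. \<lbrakk>P \<delta> K p; 0 < \<delta>'; \<delta>' \<le> \<delta>; K \<le> K'\<rbrakk> \<Longrightarrow> P \<delta>' K' p"
  shows "\<exists>\<delta>>0. \<exists>K>0. \<forall>p\<in>A. P \<delta> (K :: real) p"
proof -
  obtain d k where dk: "\<And>p0. p0 \<in> A \<Longrightarrow> d p0 > 0 \<and> k p0 > 0 \<and> (\<forall>p\<in>A \<inter> cball p0 (d p0). P (d p0) (k p0) p)"
    using loc by metis
  obtain T where T: "T \<subseteq> A" "finite T" "A \<subseteq> (\<Union>c\<in>T. ball c (d c))"
    using compactE_image[OF assms(1), of A "\<lambda>c. ball c (d c)"] dk by force
  define \<delta> where "\<delta> = Min (insert 1 (d ` T))"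
  define K where "K = Max (insert 1 (k ` T))"
  have "\<delta> > 0" using T dk by (auto simp: \<delta>_def)
  moreover have "K > 0" using T(2) by (auto simp: K_def Max_gr_iff)
  moreover have "P \<delta> K p" if "p \<in> A" for p
  proof -
    obtain c where c: "c \<in> T" "p \<in> ball c (d c)" using T(3) \<open>p \<in> A\<close> by blast
    then have "P (d c) (k c) p" using dk[of c] T(1) \<open>p \<in> A\<close> by auto
    moreover have "\<delta> \<le> d c" "k c \<le> K" using c(1) T(2) by (auto simp: \<delta>_def K_def)
    ultimately show ?thesis using mono \<open>\<delta> > 0\<close> by blast
  qed
  ultimately show ?thesis by blast
qed

lemma potential_lower_bound:
  fixes A :: "'a::euclidean_space set" and s :: real
  assumes A: "compact A" "smooth_submanifold l A" "DIM('a) = l + 1"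
    and s: "s > 0" "real l - 1 \<le> s" "s < real l"
  obtains \<delta> K where "\<delta> > 0" "K > 0" "\<And>p (J :: nat set) a m x w.
     \<lbrakk>p \<in> A; finite J; 0 < m; \<And>y. y \<in> A - a ` J \<Longrightarrow> m \<le> riesz_potential J a s y 0; (x, w) \<in> half_ball p (\<delta>\<^sup>2); x \<notin> a ` J \<or> 0 < w\<rbrakk> \<Longrightarrow>
     m * (1 - K * ((norm (x - p))\<^sup>2 + w) powr ((real l - s) / 2)) \<le> riesz_potential J a s x w"
proof -
  define P where "P \<delta> K p \<longleftrightarrow> (\<forall>(J :: nat set) a m x w.
     finite J \<and> 0 < m \<and> (\<forall>y\<in>A - a ` J. m \<le> riesz_potential J a s y 0) \<and> (x, w) \<in> half_ball p (\<delta>\<^sup>2) \<and> (x \<notin> a ` J \<or> 0 < w) \<longrightarrow>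
     m * (1 - K * ((norm (x - p))\<^sup>2 + w) powr ((real l - s) / 2)) \<le> riesz_potential J a s x w)" for \<delta> K p
  have "\<exists>\<delta>>0. \<exists>K>0. \<forall>p\<in>A. P \<delta> K p"
  proof (rule compact_locally_uniform[OF A(1)])
    show "\<exists>\<delta>>0. \<exists>K>0. \<forall>p\<in>A \<inter> cball p0 \<delta>. P \<delta> K p" if "p0 \<in> A" for p0
      unfolding P_def by (rule local_potential_lower_bound[OF A(2,3) that s])
    show "P \<delta>' K' p" if P: "P \<delta> K p" and *: "0 < \<delta>'" "\<delta>' \<le> \<delta>" "K \<le> K'" for \<delta> \<delta>' K K' p
      unfolding P_def
    proof (intro allI impI, elim conjE)
      fix J :: "nat set" and a m x w
      assume h: "finite J" "0 < m" "\<forall>y\<in>A - a ` J. m \<le> riesz_potential J a s y 0" "(x, w) \<in> half_ball p (\<delta>'\<^sup>2)" "x \<notin> a ` J \<or> 0 < w"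
      have "\<delta>'\<^sup>2 \<le> \<delta>\<^sup>2" using * by (intro power_mono) auto
      then have "(x, w) \<in> half_ball p (\<delta>\<^sup>2)" using h(4) by (auto simp: half_ball_def)
      then have "m * (1 - K * ((norm (x - p))\<^sup>2 + w) powr ((real l - s) / 2)) \<le> riesz_potential J a s x w"
        using P h unfolding P_def by blast
      moreover have "m * (1 - K' * ((norm (x - p))\<^sup>2 + w) powr ((real l - s) / 2))
          \<le> m * (1 - K * ((norm (x - p))\<^sup>2 + w) powr ((real l - s) / 2))"
        using h(2) *(3) by (intro mult_left_mono diff_left_mono mult_right_mono) auto
      ultimately show "m * (1 - K' * ((norm (x - p))\<^sup>2 + w) powr ((real l - s) / 2)) \<le> riesz_potential J a s x w" by linarith
    qed
  qed
  then obtain \<delta> K where dK: "\<delta> > 0" "K > 0" "\<And>p. p \<in> A \<Longrightarrow> P \<delta> K p" by blast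
  show ?thesis by (rule that[OF dK(1,2)]) (use dK(3) in \<open>auto simp: P_def\<close>)
qed

section \<open>Greedy points as minimizers of real-valued potentials\<close>

lemma sum_riesz_kernel:
  assumes "x \<notin> a ` J"
  shows "(\<Sum>j\<in>J. riesz_kernel s x (a j)) = ennreal (riesz_potential J a s x 0)"
proof -
  have "riesz_kernel s x (a j) = ennreal (((norm (x - a j))\<^sup>2 + 0) powr (- s / 2))" if "j \<in> J" for j
  proof -
    have ne: "x \<noteq> a j" using assms that by blast
    then have "norm (x - a j) > 0" by simp
    from power_powr[OF this, of 2 "- s / 2"]
    have "(norm (x - a j))\<^sup>2 powr (- s / 2) = norm (x - a j) powr (- s)" by simp
    then show ?thesis using ne by (simp add: riesz_kernel_off_diagonal powr_minus_divide)
  qed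
  then show ?thesis unfolding riesz_potential_def by (simp add: sum_ennreal)
qed

text \<open>Complements \<open>sum_riesz_kernel\<close> at the poles, where the real-valued
  \<open>riesz_potential\<close> does not see the infinite energy.\<close>

lemma sum_riesz_kernel_pole:
  assumes "x \<in> a ` J" "finite J"
  shows "(\<Sum>j\<in>J. riesz_kernel s x (a j)) = \<infinity>"
proof -
  obtain j where j: "j \<in> J" "x = a j" using assms by blast
  have "riesz_kernel s x (a j) \<le> (\<Sum>j\<in>J. riesz_kernel s x (a j))"
    using j assms by (intro member_le_sum) auto
  then show ?thesis using j by (simp add: riesz_kernel_diagonal top_unique)
qed

text \<open>As \<open>A\<close> is infinite, it contains a point off the earlier ones, where the
  energy is finite. So the infimum is finite, the new point is not a pole, and the extended-real
  minimality becomes one for real potentials.\<close>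

lemma greedy_minimum:
  fixes A :: "'a::euclidean_space set"
  assumes g: "greedy_energy_points s A a" and inf: "infinite A" and N: "N > 1"
  defines "J \<equiv> {1..N - 1}"
  shows "a N \<in> A" "a N \<notin> a ` J" "\<And>y. y \<in> A - a ` J \<Longrightarrow> riesz_potential J a s (a N) 0 \<le> riesz_potential J a s y 0"
proof -
  have E: "(\<Sum>j\<in>J. riesz_kernel s (a N) (a j)) = (INF y\<in>A. \<Sum>j\<in>J. riesz_kernel s y (a j))"
    using g N by (simp add: greedy_energy_points_def J_def)
  show "a N \<in> A" using g N by (simp add: greedy_energy_points_def)
  have le: "(\<Sum>j\<in>J. riesz_kernel s (a N) (a j)) \<le> ennreal (riesz_potential J a s y 0)" if "y \<in> A - a ` J" for y
    unfolding E using that sum_riesz_kernel[of y a J s] by (intro INF_lower2[of y]) auto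
  have "infinite (A - a ` J)" using inf by (simp add: J_def)
  then obtain y where "y \<in> A - a ` J" by (metis finite.emptyI ex_in_conv)
  from le[OF this] have "(\<Sum>j\<in>J. riesz_kernel s (a N) (a j)) \<noteq> \<infinity>" by (auto simp: top_unique)
  then show np: "a N \<notin> a ` J" using sum_riesz_kernel_pole[of "a N" a J s] by (auto simp: J_def)
  show "riesz_potential J a s (a N) 0 \<le> riesz_potential J a s y 0" if "y \<in> A - a ` J" for y
    using le[OF that] sum_riesz_kernel[OF np, of s] by (simp add: riesz_potential_def sum_nonneg)
qed

section \<open>Separation from the poles\<close>

text \<open>The term of \<open>a i\<close> is removed, and the lower bound for the rest is carried
  from the sphere to the centre by the minimum principle with \<open>E = {}\<close>. The pole
  \<open>a i\<close> lies in the inner half of the ball, so on the sphere its term is only of order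
  \<open>\<rho> powr (- s)\<close>. The hypothesis \<open>d\<close> says
  \<open>\<kappa> \<ge> 0\<close>.\<close>

lemma separation_from_potential:
  fixes p :: "'a::euclidean_space" and a :: "nat \<Rightarrow> 'a" and s :: real
  assumes J: "finite J" "i \<in> J" and s: "s > 0" and d: "real DIM('a) \<le> s + 2"
    and p: "p \<notin> a ` J" and \<rho>: "\<rho> > 0" "norm (p - a i) < \<rho> / 2"
    and lower: "\<And>x w. \<lbrakk>0 \<le> w; (norm (x - p))\<^sup>2 + w = \<rho>\<^sup>2; x \<notin> a ` J \<or> 0 < w\<rbrakk> \<Longrightarrow> M \<le> riesz_potential J a s x w"
  shows "norm (p - a i) powr (- s) \<le> riesz_potential J a s p 0 - M + (2 powr s + 1) * \<rho> powr (- s)"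
proof -
  define r where "r = norm (p - a i)"
  define T where "T = \<rho> powr (- s)"
  define J' where "J' = J - {i}"
  define \<kappa> where "\<kappa> = 2 * (s + 2 - DIM('a))"
  have r: "0 \<le> r" "r < \<rho> / 2" using \<rho> by (auto simp: r_def)
  have \<kappa>: "\<kappa> \<ge> 0" using d by (simp add: \<kappa>_def)
  have T: "T > 0" using \<rho> by (simp add: T_def)
  have split: "riesz_potential J a s x w = ((norm (x - a i))\<^sup>2 + w) powr (- s / 2) + riesz_potential J' a s x w" for x w
    unfolding riesz_potential_def J'_def using J by (simp add: sum.remove)
  have half: "(t\<^sup>2) powr (- s / 2) = t powr (- s)" if "t > 0" for t :: real
    using power_powr[OF that, of 2 "- s / 2"] by simp
  have i_term: "((norm (x - a i))\<^sup>2 + w) powr (- s / 2) \<le> 2 powr s * T"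
    if xw: "(norm (x - p))\<^sup>2 + w = \<rho>\<^sup>2" "0 \<le> w" for x w
  proof -
    define t where "t = norm (x - p)"
    have "t\<^sup>2 \<le> \<rho>\<^sup>2" using xw by (simp add: t_def)
    then have t: "0 \<le> t" "t \<le> \<rho>" using \<rho>(1) by (auto simp: t_def intro: power2_le_imp_le)
    have "\<bar>t - r\<bar> \<le> norm (x - a i)"
      using norm_triangle_ineq3[of "x - p" "a i - p"] by (simp add: t_def r_def norm_minus_commute)
    then have "\<bar>t - r\<bar>\<^sup>2 \<le> (norm (x - a i))\<^sup>2" by (intro power_mono) auto
    then have "(norm (x - a i))\<^sup>2 + w \<ge> (t - r)\<^sup>2 + (\<rho>\<^sup>2 - t\<^sup>2)" using xw(1) by (simp add: t_def)
    \<comment> \<open>The left side equals \<open>\<rho>\<^sup>2 - 2 * t * r + r\<^sup>2\<close>,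
      which is smallest at \<open>t = \<rho>\<close>.\<close>
    moreover have "(t - r)\<^sup>2 + (\<rho>\<^sup>2 - t\<^sup>2) \<ge> (\<rho> - r)\<^sup>2"
      using mult_right_mono[OF t(2) r(1)] by (simp add: power2_eq_square algebra_simps)
    moreover have "(\<rho> - r)\<^sup>2 \<ge> (\<rho> / 2)\<^sup>2" using r \<rho>(1) by (intro power_mono) auto
    ultimately have ge: "(\<rho> / 2)\<^sup>2 \<le> (norm (x - a i))\<^sup>2 + w" by linarith
    have "((norm (x - a i))\<^sup>2 + w) powr (- s / 2) \<le> ((\<rho> / 2)\<^sup>2) powr (- s / 2)"
      by (rule powr_mono2'[OF _ _ ge]) (use s \<rho>(1) in auto)
    also have "\<dots> = 2 powr s * T"
      using \<rho>(1) half[of "\<rho> / 2"] by (simp add: T_def powr_divide powr_minus field_simps)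
    finally show ?thesis .
  qed
  define M0 where "M0 = M - 2 powr s * T"
  \<comment> \<open>This equals \<open>M0\<close> on the sphere and \<open>M0 - T\<close> at the
    centre. The quadratic term supplies the strict sign demanded by \<open>min_principle\<close>, at
    a cost of the same order as the removed term.\<close>
  let ?g = "\<lambda>x w. (M0 - T) + (T / \<rho>\<^sup>2) * ((norm (x - p))\<^sup>2 + w)"
  have "?g p 0 \<le> riesz_potential J' a s p 0"
  proof (rule min_principle[where E = "{}" and p = p and R = "\<rho>\<^sup>2" and \<kappa> = \<kappa> and g = ?g])
    show "finite J'" using J by (simp add: J'_def)
    show "continuous_on (half_ball p (\<rho>\<^sup>2)) (\<lambda>X. ?g (fst X) (snd X))" by (intro continuous_intros)
    show "\<exists>v>0. has_L \<kappa> ?g x w v" for x w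
    proof (intro exI conjI)
      show "has_L \<kappa> ?g x w (0 + (T / \<rho>\<^sup>2) * (2 * DIM('a) + \<kappa>))"
        by (rule has_L_add[OF has_L_const has_L_cmult[OF has_L_normsq]])
      show "0 + (T / \<rho>\<^sup>2) * (2 * DIM('a) + \<kappa>) > 0"
        using T \<rho>(1) \<kappa> by (simp add: add_pos_nonneg)
    qed
    show "?g x w \<le> riesz_potential J' a s x w"
      if xw: "0 \<le> w" "(norm (x - p))\<^sup>2 + w = \<rho>\<^sup>2 \<or> x \<in> {} \<and> w = 0" "x \<notin> a ` J' \<or> 0 < w" for x w
    proof -
      have sph: "(norm (x - p))\<^sup>2 + w = \<rho>\<^sup>2" using xw(2) by simp
      \<comment> \<open>The only pole lost in passing from \<open>J\<close> to \<open>J'\<close> can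
        be \<open>a i\<close>, which is too close to \<open>p\<close> to lie on the sphere.\<close>
      have "x \<notin> a ` J \<or> 0 < w"
      proof (rule ccontr)
        assume "\<not> ?thesis"
        then have "x = a i" "w = 0" using xw(1,3) by (auto simp: J'_def)
        then have "r\<^sup>2 = \<rho>\<^sup>2" using sph by (simp add: r_def norm_minus_commute)
        then show False using r \<rho>(1) by simp
      qed
      then have "M \<le> riesz_potential J a s x w" using lower xw(1) sph by blast
      then have "M0 \<le> riesz_potential J' a s x w" using i_term[OF sph xw(1)] split[of x w] by (simp add: M0_def)
      then show ?thesis unfolding sph using \<rho>(1) by simp
    qed
  qed (use s \<kappa> p \<rho>(1) in \<open>auto simp: \<kappa>_def J'_def\<close>)
  then have "M0 - T \<le> riesz_potential J' a s p 0" by simp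
  moreover have "riesz_potential J a s p 0 = r powr (- s) + riesz_potential J' a s p 0"
  proof -
    have "r > 0" using p J(2) by (auto simp: r_def)
    then show ?thesis using split[of p 0] half[of r] by (simp add: r_def)
  qed
  ultimately show ?thesis by (simp add: M0_def r_def T_def algebra_simps)
qed

lemma greedy_separation:
  fixes A :: "'a::euclidean_space set" and s :: real
  assumes l: "l \<ge> 1" and dim: "DIM('a) = l + 1" and A: "compact A" "smooth_submanifold l A"
    and s: "s > 0" "real l - 1 \<le> s" "s < real l"
  shows "\<exists>c>0. \<forall>a. greedy_energy_points s A a \<longrightarrow>
      (\<forall>i j. 1 \<le> i \<and> i < j \<longrightarrow> c * real j powr (- 1 / real l) \<le> norm (a i - a j))"
proof -
  obtain \<delta> K where \<delta>: "\<delta> > 0" and K: "K > 0" and low: "\<And>p (J :: nat set) a m x w.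
     \<lbrakk>p \<in> A; finite J; 0 < m; \<And>y. y \<in> A - a ` J \<Longrightarrow> m \<le> riesz_potential J a s y 0; (x, w) \<in> half_ball p (\<delta>\<^sup>2); x \<notin> a ` J \<or> 0 < w\<rbrakk> \<Longrightarrow>
     m * (1 - K * ((norm (x - p))\<^sup>2 + w) powr ((real l - s) / 2)) \<le> riesz_potential J a s x w"
    using potential_lower_bound[OF A dim s] by blast
  define \<gamma> where "\<gamma> = (real l - s) / 2"
  have \<gamma>: "\<gamma> > 0" using s by (simp add: \<gamma>_def)
  \<comment> \<open>A squared height above \<open>p\<close> at which the loss
    \<open>K * w0 powr \<gamma>\<close> is at most 1/2. There the potential is at least
    \<open>m / 2\<close>, while each term is at most \<open>w0 powr (- s / 2)\<close>; this gives
    \<open>m \<le> C0 * N\<close>.\<close>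
  define w0 where "w0 = min (\<delta>\<^sup>2) ((1 / (2 * K)) powr (1 / \<gamma>))"
  have w0: "w0 > 0" "w0 \<le> \<delta>\<^sup>2" using \<delta> K by (auto simp: w0_def)
  have Kw0: "K * w0 powr \<gamma> \<le> 1 / 2"
  proof -
    have "w0 powr \<gamma> \<le> ((1 / (2 * K)) powr (1 / \<gamma>)) powr \<gamma>"
      using w0(1) \<gamma> by (intro powr_mono2) (auto simp: w0_def)
    also have "\<dots> = 1 / (2 * K)" using \<gamma> K by (simp add: powr_powr)
    finally show ?thesis using K by (simp add: field_simps)
  qed
  define C0 where "C0 = 2 * w0 powr (- s / 2)"
  \<comment> \<open>The first summand comes from the loss
    \<open>m * K * \<rho> powr (l - s)\<close>, the other two from
    \<open>separation_from_potential\<close>, all in units of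
    \<open>\<rho> powr (- s)\<close>.\<close>
  define C2 where "C2 = C0 * K * \<delta> powr l + 2 powr s + 1"
  have C0: "C0 > 0" using w0 by (simp add: C0_def)
  have C2: "C2 > 0" using C0 K by (simp add: C2_def add_nonneg_pos)
  \<comment> \<open>The minimum serves two cases: either the distance is at least
    \<open>\<rho> / 2\<close>, or the potential estimate bounds it below by
    \<open>C2 powr (- 1 / s) * \<rho>\<close>.\<close>
  define c where "c = min (1 / 2) (C2 powr (- 1 / s)) * \<delta>"
  have c: "c > 0" using C2 \<delta> by (simp add: c_def)
  have main: "c * real N powr (- 1 / real l) \<le> norm (a i - a N)"
    if g: "greedy_energy_points s A a" and iN: "1 \<le> i" "i < N" for a i N
  proof -
    define J where "J = {1..N - 1}"
    define p where "p = a N"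
    \<comment> \<open>The scale at which \<open>N * \<rho> powr l\<close> is the constant
      \<open>\<delta> powr l\<close>. It is at most \<open>\<delta>\<close>, so the sphere stays
      where the lower bound holds.\<close>
    define \<rho> where "\<rho> = \<delta> * real N powr (- 1 / real l)"
    define m where "m = riesz_potential J a s p 0"
    have J: "finite J" "i \<in> J" using iN by (auto simp: J_def)
    have N1: "N > 1" using iN by simp
    have "infinite A"
      using smooth_submanifold_infinite[OF A(2) l] greedy_energy_points_def[of s A a] g by blast
    note gm = greedy_minimum[OF g this N1, folded J_def]
    have pA: "p \<in> A" and pJ: "p \<notin> a ` J" using gm by (auto simp: p_def)
    have mmin: "m \<le> riesz_potential J a s y 0" if "y \<in> A - a ` J" for y using gm(3)[OF that] by (simp add: m_def p_def)
    have m0: "m > 0" unfolding m_def riesz_potential_def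
      by (rule sum_pos2[OF J]) (use pJ J in auto)
    have mN: "m \<le> C0 * N"
    proof -
      have "m * (1 - K * ((norm (p - p))\<^sup>2 + w0) powr \<gamma>) \<le> riesz_potential J a s p w0"
        unfolding \<gamma>_def by (rule low[OF pA J(1) m0 mmin]) (use w0 in \<open>auto simp: half_ball_def\<close>)
      moreover have "m * (1 / 2) \<le> m * (1 - K * w0 powr \<gamma>)"
        using Kw0 m0 by (intro mult_left_mono) auto
      moreover have "riesz_potential J a s p w0 \<le> (\<Sum>j\<in>J. w0 powr (- s / 2))"
        unfolding riesz_potential_def using w0 s by (intro sum_mono powr_mono2') auto
      moreover have "(\<Sum>j\<in>J. w0 powr (- s / 2)) \<le> N * w0 powr (- s / 2)"
        by (simp add: J_def mult_right_mono)
      ultimately have "m * (1 / 2) \<le> N * w0 powr (- s / 2)" by simp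
      then show ?thesis by (simp add: C0_def algebra_simps)
    qed
    have \<rho>0: "\<rho> > 0" using \<delta> N1 by (simp add: \<rho>_def)
    have "real N powr (- 1 / real l) \<le> 1"
      using N1 powr_mono[of "- 1 / real l" 0 "real N"] by simp
    then have "\<rho> \<le> \<delta> * 1" unfolding \<rho>_def using \<delta> by (intro mult_left_mono) auto
    then have \<rho>\<delta>: "\<rho>\<^sup>2 \<le> \<delta>\<^sup>2" using \<rho>0 by (intro power_mono) auto
    have c_le: "c * real N powr (- 1 / real l) \<le> min (1 / 2) (C2 powr (- 1 / s)) * \<rho>"
      by (simp add: c_def \<rho>_def)
    show ?thesis
    proof (cases "norm (p - a i) < \<rho> / 2")
      case False
      have "min (1 / 2) (C2 powr (- 1 / s)) * \<rho> \<le> 1 / 2 * \<rho>" using \<rho>0 by (intro mult_right_mono) auto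
      then show ?thesis using False c_le by (simp add: p_def norm_minus_commute)
    next
      case True
      have "real 2 * \<gamma> = real l - s" by (simp add: \<gamma>_def)
      then have \<rho>\<gamma>: "(\<rho>\<^sup>2) powr \<gamma> = \<rho> powr (l - s)"
        using power_powr[OF \<rho>0, of 2 \<gamma>] by (simp only:)
      have d: "real DIM('a) \<le> s + 2" using s(2) dim by simp
      have "m * (1 - K * \<rho> powr (l - s)) \<le> riesz_potential J a s x w"
        if "0 \<le> w" "(norm (x - p))\<^sup>2 + w = \<rho>\<^sup>2" "x \<notin> a ` J \<or> 0 < w" for x w
        using low[OF pA J(1) m0 mmin, of x w] that \<rho>\<delta> \<rho>\<gamma> unfolding \<gamma>_def[symmetric]
        by (simp add: half_ball_def)
      from separation_from_potential[OF J s(1) d pJ \<rho>0 True this]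
      have "norm (p - a i) powr (- s) \<le> m - m * (1 - K * \<rho> powr (l - s)) + (2 powr s + 1) * \<rho> powr (- s)"
        unfolding m_def .
      also have "m - m * (1 - K * \<rho> powr (l - s)) = m * (K * \<rho> powr (l - s))" by (simp add: algebra_simps)
      also have "\<dots> \<le> (C0 * N) * (K * \<rho> powr (l - s))"
        using mN K by (intro mult_right_mono) auto
      \<comment> \<open>The linear growth of \<open>m\<close> in \<open>N\<close> is balanced by
        \<open>N * \<rho> powr l = \<delta> powr l\<close>, which removes \<open>N\<close> from the
        constant.\<close>
      also have "\<dots> = C0 * K * \<delta> powr l * \<rho> powr (- s)"
      proof -
        have "real N powr (- 1 / real l * real l) = 1 / N" using N1 l by (simp add: powr_neg_one)
        then have "(real N powr (- 1 / real l)) powr l = 1 / N" by (simp only: powr_powr)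
        moreover have "\<rho> powr l = \<delta> powr l * (real N powr (- 1 / real l)) powr l"
          using \<delta> unfolding \<rho>_def by (intro powr_mult)
        ultimately have "\<rho> powr l = \<delta> powr l / N" by simp
        then have "N * \<rho> powr l = \<delta> powr l" using N1 by simp
        moreover have "\<rho> powr (l - s) = \<rho> powr l * \<rho> powr (- s)" by (simp flip: powr_add)
        ultimately show ?thesis by (simp add: algebra_simps)
      qed
      finally have le: "norm (p - a i) powr (- s) \<le> C2 * \<rho> powr (- s)"
        by (simp add: C2_def algebra_simps)
      have r0: "norm (p - a i) > 0" using pJ J(2) by auto
      have "(C2 * \<rho> powr (- s)) powr (- 1 / s) \<le> (norm (p - a i) powr (- s)) powr (- 1 / s)"
        by (rule powr_mono2'[OF _ _ le]) (use s r0 in auto)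
      then have "C2 powr (- 1 / s) * \<rho> \<le> norm (p - a i)"
        using s r0 \<rho>0 C2 by (simp add: powr_mult powr_powr)
      moreover have "min (1 / 2) (C2 powr (- 1 / s)) * \<rho> \<le> C2 powr (- 1 / s) * \<rho>"
        using \<rho>0 by (intro mult_right_mono) auto
      ultimately show ?thesis using c_le by (simp add: p_def norm_minus_commute)
    qed
  qed
  show ?thesis using c main by blast
qed

theorem theorem2p4:
  fixes A :: "(real ^ 'n::finite) set" and l :: nat and s :: real
  assumes "l \<ge> 1"
    and "CARD('n) = l + 1"
    and "compact A"
    and "smooth_submanifold l A"
    and "s > 0"
    and "real l - 1 \<le> s"
    and "s < real l"
  shows "\<exists>c::real. c > 0 \<and>
    (\<forall>a. greedy_energy_points s A a \<longrightarrow>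
      (\<forall>i j. 1 \<le> i \<and> i < j \<longrightarrow>
        norm (a i - a j) \<ge> c * real j powr (- 1 / real l)))"
  using greedy_separation[OF assms(1) _ assms(3-7)] assms(2) by simp

end
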